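(* Let $C$ be a command of $\mathrm{LOOP}_D$ in which every subcommand of the form $\mathrm{while}_\prec\ \phi\ \mathrm{do}\ C_1$ satisfies that $\forall s(\phi(s)\to C_1^+s\prec s)$ is provable in $\mathrm{WE}\text{-}\mathrm{HA}^\omega$. Then for every state $s:S$ there exist $s':S$, $\sigma:S^\ast$ and $\Gamma:(S\to T\to T)^\ast$ such that $(s,C)\Downarrow(s',\sigma,\Gamma)$ and $s'=C^+s$ in $\mathrm{WE}\text{-}\mathrm{HA}^\omega$, and such that for every $t:T$, $\sigma_0:S^\ast$ and $\Gamma_0:(S\to T\to T)^\ast$ there exists $t':T$ with $(\sigma::\sigma_0,\Gamma::\Gamma_0,t)\Rightarrow(\sigma_0,\Gamma_0,t')$ and $t'=C^-st$ in $\mathrm{WE}\text{-}\mathrm{HA}^\omega$.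
   Context: Setting: $\mathrm{WE}\text{-}\mathrm{HA}^\omega$ (intuitionistic arithmetic in all finite types with System T terms and case constructor) extended with abstract state types $S,T$ with decidable equality, forward primitive commands $c:S\to S$ (set $\mathtt{Comm}^+$), backward primitive commands $\gamma:S\to T\to T$ (set $\mathtt{Comm}^-$), decidable predicates $\phi$ on $S$ (set $\mathtt{Exp}$), decidable wellfounded relations $\prec$ on $S$ (set $\mathtt{Rel}$). Commands: $C::=\mathtt{skip}\mid\langle c,\gamma\rangle\mid C;C\mid\mathrm{if}\ \phi\ \mathrm{then}\ C\ \mathrm{else}\ C\mid\mathrm{while}_\prec\ \phi\ \mathrm{do}\ C$. Each command denotes a pair $\langle C^+,C^-\rangle$, $C^+:S\to S$, $C^-:S\to T\to T$: $\mathtt{skip}^+=\lambda s.s$, $\mathtt{skip}^-=\lambda s,t.t$; $\langle c,\gamma\rangle^+=c$, $\langle c,\gamma\rangle^-=\gamma$; $(C_1;C_2)^+=C_2^+\circ C_1^+$, $(C_1;C_2)^-=\lambda s,t.C_1^-s(C_2^-(C_1^+s)t)$; the conditional's components are the case split on $\phi(s)$ between those of $C_1$ and $C_2$; $(\mathrm{while}_\prec\ \phi\ \mathrm{do}\ C)^+=\mathbf{W}^{\prec,\phi,C^+}(\lambda s.s)(\lambda s,y.y)$ and $(\mathrm{while}_\prec\ \phi\ \mathrm{do}\ C)^-=\mathbf{W}^{\prec,\phi,C^+}(\lambda s,t.t)(\lambda s,f,t.C^-s(ft))$, where the while recursor satisfies $(\phi(s)\to as\prec s)\to\mathbf{W}^{\prec,\phi,a}uFs=(\text{if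 }\phi(s)\text{ then }Fs(\mathbf{W}^{\prec,\phi,a}uF(as))\text{ else }us)$. For a type $X$, $X^\ast$ is the type of finite sequences, $\epsilon$ the empty sequence, $\tau::\sigma$ concatenation and $x::\sigma$ prepending an element. The forward relation $(s,C)\Downarrow(s',\sigma,\Gamma)$ is inductively defined by: $(s,\mathtt{skip})\Downarrow(s,\epsilon,\epsilon)$; $(s,\langle c,\gamma\rangle)\Downarrow(cs,[s],[\gamma])$; if $(s,C_1)\Downarrow(s',\sigma,\Gamma)$ and $(s',C_2)\Downarrow(s'',\sigma',\Gamma')$ then $(s,C_1;C_2)\Downarrow(s'',\sigma'::\sigma,\Gamma'::\Gamma)$; if $\phi(s)$ and $(s,C_1)\Downarrow(s',\sigma,\Gamma)$ then $(s,\mathrm{if}\ \phi\ \mathrm{then}\ C_1\ \mathrm{else}\ C_2)\Downarrow(s',\sigma,\Gamma)$; if $\neg\phi(s)$ and $(s,C_2)\Downarrow(s',\sigma,\Gamma)$ then likewise; if $\phi(s)$, $(s,C)\Downarrow(s',\sigma,\Gamma)$, $s'\prec s$ and $(s',\mathrm{while}_\prec\ \phi\ \mathrm{do}\ C)\Downarrow(s'',\sigma',\Gamma')$ then $(s,\mathrm{while}_\prec\ \phi\ \mathrm{do}\ C)\Downarrow(s'',\sigma'::\sigma,\Gamma'::\Gamma)$; if $\neg\phi(s)$ then $(s,\mathrm{while}_\prec\ \phi\ \mathrm{do}\ C)\Downarrow(s,\epsilon,\epsilon)$. The backward relation $(\sigma,\Gamma,t)\Rightarrow(\sigma',\Gamma',t')$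 is inductively defined by: $(\sigma,\Gamma,t)\Rightarrow(\sigma,\Gamma,t)$; $(s::\sigma,\gamma::\Gamma,t)\Rightarrow(\sigma,\Gamma,\gamma st)$; and transitivity: if $(\sigma,\Gamma,t)\Rightarrow(\sigma',\Gamma',t')$ and $(\sigma',\Gamma',t')\Rightarrow(\sigma'',\Gamma'',t'')$ then $(\sigma,\Gamma,t)\Rightarrow(\sigma'',\Gamma'',t'')$. *)

theory Defs
  imports Main
begin

text \<open>
  A deep embedding of WE-HA in all finite types over the base types of natural numbers,
  states (\<open>S\<close>) and backward states (\<open>T\<close>). The abstract types are interpreted by HOL types
  \<open>'s\<close> and \<open>'t\<close>: a primitive symbol is identified with the HOL function, predicate or relation
  it stands for, and every element of \<open>'s\<close> and \<open>'t\<close> has a name in the language.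
\<close>

section \<open>Types and terms\<close>

datatype ty = N | S | T | Fun ty ty (infixr "\<rightarrow>\<^sub>t" 60)

definition base :: "ty \<Rightarrow> bool" where
  "base \<tau> \<longleftrightarrow> \<tau> = N \<or> \<tau> = S \<or> \<tau> = T"

text \<open>
  Variables carry their type. Following the usual presentation of WE-HA, terms are built from
  combinators, and abstraction is defined below. In a relation \<open>r\<close>, the pair \<open>(s', s)\<close> means
  \<open>s' \<prec> s\<close>.
\<close>

datatype (dead 's, dead 't) trm =
    Var nat ty
  | App "('s, 't) trm" "('s, 't) trm" (infixl "\<cdot>" 100)
  | Zero
  | Succ
  | CombK ty ty
  | CombS ty ty ty
  | Rec ty
  | CaseEq ty ty
  | CaseExp "'s \<Rightarrow> bool" ty
  | CaseRel "('s \<times> 's) set" ty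
  | WRec "('s \<times> 's) set" "'s \<Rightarrow> bool" ty
  | StateS 's
  | StateT 't
  | Fwd "'s \<Rightarrow> 's"
  | Bwd "'s \<Rightarrow> 't \<Rightarrow> 't"

text \<open>The value of \<open>ty_of\<close> is meaningful on well-typed terms only.\<close>

fun ty_of :: "('s, 't) trm \<Rightarrow> ty" where
  "ty_of (Var x \<tau>) = \<tau>"
| "ty_of (t \<cdot> u) = (case ty_of t of \<rho> \<rightarrow>\<^sub>t \<tau> \<Rightarrow> \<tau> | _ \<Rightarrow> N)"
| "ty_of Zero = N"
| "ty_of Succ = N \<rightarrow>\<^sub>t N"
| "ty_of (CombK \<rho> \<tau>) = \<rho> \<rightarrow>\<^sub>t \<tau> \<rightarrow>\<^sub>t \<rho>"
| "ty_of (CombS \<rho> \<sigma> \<tau>) = (\<rho> \<rightarrow>\<^sub>t \<sigma> \<rightarrow>\<^sub>t \<tau>) \<rightarrow>\<^sub>t (\<rho> \<rightarrow>\<^sub>t \<sigma>) \<rightarrow>\<^sub>t \<rho> \<rightarrow>\<^sub>t \<tau>"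
| "ty_of (Rec \<rho>) = N \<rightarrow>\<^sub>t \<rho> \<rightarrow>\<^sub>t (\<rho> \<rightarrow>\<^sub>t N \<rightarrow>\<^sub>t \<rho>) \<rightarrow>\<^sub>t \<rho>"
| "ty_of (CaseEq \<beta> \<rho>) = \<beta> \<rightarrow>\<^sub>t \<beta> \<rightarrow>\<^sub>t \<rho> \<rightarrow>\<^sub>t \<rho> \<rightarrow>\<^sub>t \<rho>"
| "ty_of (CaseExp \<phi> \<rho>) = S \<rightarrow>\<^sub>t \<rho> \<rightarrow>\<^sub>t \<rho> \<rightarrow>\<^sub>t \<rho>"
| "ty_of (CaseRel r \<rho>) = S \<rightarrow>\<^sub>t S \<rightarrow>\<^sub>t \<rho> \<rightarrow>\<^sub>t \<rho> \<rightarrow>\<^sub>t \<rho>"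
| "ty_of (WRec r \<phi> \<rho>) = (S \<rightarrow>\<^sub>t S) \<rightarrow>\<^sub>t (S \<rightarrow>\<^sub>t \<rho>) \<rightarrow>\<^sub>t (S \<rightarrow>\<^sub>t \<rho> \<rightarrow>\<^sub>t \<rho>) \<rightarrow>\<^sub>t S \<rightarrow>\<^sub>t \<rho>"
| "ty_of (StateS s) = S"
| "ty_of (StateT t) = T"
| "ty_of (Fwd c) = S \<rightarrow>\<^sub>t S"
| "ty_of (Bwd \<gamma>) = S \<rightarrow>\<^sub>t T \<rightarrow>\<^sub>t T"

primrec fv :: "('s, 't) trm \<Rightarrow> (nat \<times> ty) set" where
  "fv (Var x \<tau>) = {(x, \<tau>)}"
| "fv (t \<cdot> u) = fv t \<union> fv u"
| "fv Zero = {}"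
| "fv Succ = {}"
| "fv (CombK \<rho> \<tau>) = {}"
| "fv (CombS \<rho> \<sigma> \<tau>) = {}"
| "fv (Rec \<rho>) = {}"
| "fv (CaseEq \<beta> \<rho>) = {}"
| "fv (CaseExp \<phi> \<rho>) = {}"
| "fv (CaseRel r \<rho>) = {}"
| "fv (WRec r \<phi> \<rho>) = {}"
| "fv (StateS s) = {}"
| "fv (StateT t) = {}"
| "fv (Fwd c) = {}"
| "fv (Bwd \<gamma>) = {}"

fun tsubst :: "nat \<Rightarrow> ty \<Rightarrow> ('s, 't) trm \<Rightarrow> ('s, 't) trm \<Rightarrow> ('s, 't) trm" where
  "tsubst x \<rho> u (Var y \<tau>) = (if (y, \<tau>) = (x, \<rho>) then u else Var y \<tau>)"
| "tsubst x \<rho> u (t \<cdot> t') = tsubst x \<rho> u t \<cdot> tsubst x \<rho> u t'"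
| "tsubst x \<rho> u t = t"

text \<open>\<open>lam x \<rho> t\<close> is the term written \<open>\<lambda>x\<^sup>\<rho>. t\<close> in the calculus, by bracket abstraction.\<close>

fun lam :: "nat \<Rightarrow> ty \<Rightarrow> ('s, 't) trm \<Rightarrow> ('s, 't) trm" where
  "lam x \<rho> (Var y \<tau>) =
     (if (y, \<tau>) = (x, \<rho>) then CombS \<rho> (\<rho> \<rightarrow>\<^sub>t \<rho>) \<rho> \<cdot> CombK \<rho> (\<rho> \<rightarrow>\<^sub>t \<rho>) \<cdot> CombK \<rho> \<rho>
      else CombK \<tau> \<rho> \<cdot> Var y \<tau>)"
| "lam x \<rho> (t \<cdot> u) = CombS \<rho> (ty_of u) (ty_of (t \<cdot> u)) \<cdot> lam x \<rho> t \<cdot> lam x \<rho> u"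
| "lam x \<rho> t = CombK (ty_of t) \<rho> \<cdot> t"

section \<open>Formulas\<close>

datatype (dead 's, dead 't) fm =
    Eq "('s, 't) trm" "('s, 't) trm"
  | Exp "'s \<Rightarrow> bool" "('s, 't) trm"
  | Rel "('s \<times> 's) set" "('s, 't) trm" "('s, 't) trm"
  | Fls
  | And "('s, 't) fm" "('s, 't) fm"
  | Or "('s, 't) fm" "('s, 't) fm"
  | Imp "('s, 't) fm" "('s, 't) fm"
  | All nat ty "('s, 't) fm"
  | Ex nat ty "('s, 't) fm"

abbreviation Neg :: "('s, 't) fm \<Rightarrow> ('s, 't) fm" where
  "Neg A \<equiv> Imp A Fls"

primrec ffv :: "('s, 't) fm \<Rightarrow> (nat \<times> ty) set" where
  "ffv (Eq t u) = fv t \<union> fv u"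
| "ffv (Exp \<phi> t) = fv t"
| "ffv (Rel r t u) = fv t \<union> fv u"
| "ffv Fls = {}"
| "ffv (And A B) = ffv A \<union> ffv B"
| "ffv (Or A B) = ffv A \<union> ffv B"
| "ffv (Imp A B) = ffv A \<union> ffv B"
| "ffv (All x \<tau> A) = ffv A - {(x, \<tau>)}"
| "ffv (Ex x \<tau> A) = ffv A - {(x, \<tau>)}"

text \<open>Substitution does not rename bound variables; it is only used under \<open>free_for\<close>.\<close>

primrec fsubst :: "nat \<Rightarrow> ty \<Rightarrow> ('s, 't) trm \<Rightarrow> ('s, 't) fm \<Rightarrow> ('s, 't) fm" where
  "fsubst x \<rho> u (Eq a b) = Eq (tsubst x \<rho> u a) (tsubst x \<rho> u b)"
| "fsubst x \<rho> u (Exp \<phi> a) = Exp \<phi> (tsubst x \<rho> u a)"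
| "fsubst x \<rho> u (Rel r a b) = Rel r (tsubst x \<rho> u a) (tsubst x \<rho> u b)"
| "fsubst x \<rho> u Fls = Fls"
| "fsubst x \<rho> u (And A B) = And (fsubst x \<rho> u A) (fsubst x \<rho> u B)"
| "fsubst x \<rho> u (Or A B) = Or (fsubst x \<rho> u A) (fsubst x \<rho> u B)"
| "fsubst x \<rho> u (Imp A B) = Imp (fsubst x \<rho> u A) (fsubst x \<rho> u B)"
| "fsubst x \<rho> u (All y \<tau> A) = All y \<tau> (if (y, \<tau>) = (x, \<rho>) then A else fsubst x \<rho> u A)"
| "fsubst x \<rho> u (Ex y \<tau> A) = Ex y \<tau> (if (y, \<tau>) = (x, \<rho>) then A else fsubst x \<rho> u A)"

primrec free_for :: "('s, 't) trm \<Rightarrow> nat \<Rightarrow> ty \<Rightarrow> ('s, 't) fm \<Rightarrow> bool" where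
  "free_for u x \<rho> (Eq a b) \<longleftrightarrow> True"
| "free_for u x \<rho> (Exp \<phi> a) \<longleftrightarrow> True"
| "free_for u x \<rho> (Rel r a b) \<longleftrightarrow> True"
| "free_for u x \<rho> Fls \<longleftrightarrow> True"
| "free_for u x \<rho> (And A B) \<longleftrightarrow> free_for u x \<rho> A \<and> free_for u x \<rho> B"
| "free_for u x \<rho> (Or A B) \<longleftrightarrow> free_for u x \<rho> A \<and> free_for u x \<rho> B"
| "free_for u x \<rho> (Imp A B) \<longleftrightarrow> free_for u x \<rho> A \<and> free_for u x \<rho> B"
| "free_for u x \<rho> (All y \<tau> A) \<longleftrightarrow>
     (x, \<rho>) \<notin> ffv (All y \<tau> A) \<or> ((y, \<tau>) \<notin> fv u \<and> free_for u x \<rho> A)"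
| "free_for u x \<rho> (Ex y \<tau> A) \<longleftrightarrow>
     (x, \<rho>) \<notin> ffv (Ex y \<tau> A) \<or> ((y, \<tau>) \<notin> fv u \<and> free_for u x \<rho> A)"

primrec qf :: "('s, 't) fm \<Rightarrow> bool" where
  "qf (Eq t u) \<longleftrightarrow> True"
| "qf (Exp \<phi> t) \<longleftrightarrow> True"
| "qf (Rel r t u) \<longleftrightarrow> True"
| "qf Fls \<longleftrightarrow> True"
| "qf (And A B) \<longleftrightarrow> qf A \<and> qf B"
| "qf (Or A B) \<longleftrightarrow> qf A \<and> qf B"
| "qf (Imp A B) \<longleftrightarrow> qf A \<and> qf B"
| "qf (All x \<tau> A) \<longleftrightarrow> False"
| "qf (Ex x \<tau> A) \<longleftrightarrow> False"

text \<open>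
  Equality is primitive at base types only; at higher types \<open>t \<doteq> u\<close> abbreviates
  \<open>\<forall>x\<^sub>1 \<dots> x\<^sub>n. t x\<^sub>1 \<dots> x\<^sub>n = u x\<^sub>1 \<dots> x\<^sub>n\<close> with fresh variables.
\<close>

fun fresh :: "('s, 't) trm \<Rightarrow> nat" where
  "fresh (Var x \<tau>) = Suc x"
| "fresh (t \<cdot> u) = max (fresh t) (fresh u)"
| "fresh t = 0"

fun eq_at :: "ty \<Rightarrow> ('s, 't) trm \<Rightarrow> ('s, 't) trm \<Rightarrow> ('s, 't) fm" where
  "eq_at (\<rho> \<rightarrow>\<^sub>t \<tau>) t u =
     (let x = max (fresh t) (fresh u) in All x \<rho> (eq_at \<tau> (t \<cdot> Var x \<rho>) (u \<cdot> Var x \<rho>)))"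
| "eq_at \<tau> t u = Eq t u"

definition eq :: "('s, 't) trm \<Rightarrow> ('s, 't) trm \<Rightarrow> ('s, 't) fm" (infix "\<doteq>" 55) where
  "t \<doteq> u = eq_at (ty_of t) t u"

section \<open>Signatures\<close>

text \<open>
  The field \<open>state_axioms\<close> collects whatever further facts about the abstract primitives the
  theory is to contain beyond the ground ones (possibly none). Any set of quantifier-free formulas
  over the primitives that are universally valid for the given states is admitted.
\<close>

record ('s, 't) sig =
  Comm_plus :: "('s \<Rightarrow> 's) set"
  Comm_minus :: "('s \<Rightarrow> 't \<Rightarrow> 't) set"
  Exps :: "('s \<Rightarrow> bool) set"
  Rels :: "('s \<times> 's) set set"
  state_axioms :: "('s, 't) fm set"

fun wt :: "('s, 't) sig \<Rightarrow> ('s, 't) trm \<Rightarrow> bool" where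
  "wt \<Sigma> (t \<cdot> u) \<longleftrightarrow> wt \<Sigma> t \<and> wt \<Sigma> u \<and> (\<exists>\<tau>. ty_of t = (ty_of u \<rightarrow>\<^sub>t \<tau>))"
| "wt \<Sigma> (CaseEq \<beta> \<rho>) \<longleftrightarrow> base \<beta>"
| "wt \<Sigma> (CaseExp \<phi> \<rho>) \<longleftrightarrow> \<phi> \<in> Exps \<Sigma>"
| "wt \<Sigma> (CaseRel r \<rho>) \<longleftrightarrow> r \<in> Rels \<Sigma>"
| "wt \<Sigma> (WRec r \<phi> \<rho>) \<longleftrightarrow> r \<in> Rels \<Sigma> \<and> \<phi> \<in> Exps \<Sigma>"
| "wt \<Sigma> (Fwd c) \<longleftrightarrow> c \<in> Comm_plus \<Sigma>"
| "wt \<Sigma> (Bwd \<gamma>) \<longleftrightarrow> \<gamma> \<in> Comm_minus \<Sigma>"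
| "wt \<Sigma> t \<longleftrightarrow> True"

primrec wff :: "('s, 't) sig \<Rightarrow> ('s, 't) fm \<Rightarrow> bool" where
  "wff \<Sigma> (Eq t u) \<longleftrightarrow> wt \<Sigma> t \<and> wt \<Sigma> u \<and> ty_of t = ty_of u \<and> base (ty_of t)"
| "wff \<Sigma> (Exp \<phi> t) \<longleftrightarrow> \<phi> \<in> Exps \<Sigma> \<and> wt \<Sigma> t \<and> ty_of t = S"
| "wff \<Sigma> (Rel r t u) \<longleftrightarrow> r \<in> Rels \<Sigma> \<and> wt \<Sigma> t \<and> wt \<Sigma> u \<and> ty_of t = S \<and> ty_of u = S"
| "wff \<Sigma> Fls \<longleftrightarrow> True"
| "wff \<Sigma> (And A B) \<longleftrightarrow> wff \<Sigma> A \<and> wff \<Sigma> B"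
| "wff \<Sigma> (Or A B) \<longleftrightarrow> wff \<Sigma> A \<and> wff \<Sigma> B"
| "wff \<Sigma> (Imp A B) \<longleftrightarrow> wff \<Sigma> A \<and> wff \<Sigma> B"
| "wff \<Sigma> (All x \<tau> A) \<longleftrightarrow> wff \<Sigma> A"
| "wff \<Sigma> (Ex x \<tau> A) \<longleftrightarrow> wff \<Sigma> A"

text \<open>
  Evaluation is meaningful only on terms satisfying \<open>S_term\<close> or \<open>T_term\<close> and formulas satisfying
  \<open>state_fm\<close>.
\<close>

fun S_term :: "('s, 't) trm \<Rightarrow> bool" where
  "S_term (Var x \<tau>) \<longleftrightarrow> \<tau> = S"
| "S_term (StateS s) \<longleftrightarrow> True"
| "S_term (Fwd c \<cdot> a) \<longleftrightarrow> S_term a"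
| "S_term _ \<longleftrightarrow> False"

fun S_val :: "(nat \<Rightarrow> 's) \<Rightarrow> ('s, 't) trm \<Rightarrow> 's" where
  "S_val e (Var x \<tau>) = e x"
| "S_val e (StateS s) = s"
| "S_val e (Fwd c \<cdot> a) = c (S_val e a)"
| "S_val e _ = undefined"

fun T_term :: "('s, 't) trm \<Rightarrow> bool" where
  "T_term (Var x \<tau>) \<longleftrightarrow> \<tau> = T"
| "T_term (StateT t) \<longleftrightarrow> True"
| "T_term (Bwd \<gamma> \<cdot> a \<cdot> b) \<longleftrightarrow> S_term a \<and> T_term b"
| "T_term _ \<longleftrightarrow> False"

fun T_val :: "(nat \<Rightarrow> 's) \<Rightarrow> (nat \<Rightarrow> 't) \<Rightarrow> ('s, 't) trm \<Rightarrow> 't" where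
  "T_val e f (Var x \<tau>) = f x"
| "T_val e f (StateT t) = t"
| "T_val e f (Bwd \<gamma> \<cdot> a \<cdot> b) = \<gamma> (S_val e a) (T_val e f b)"
| "T_val e f _ = undefined"

primrec state_fm :: "('s, 't) fm \<Rightarrow> bool" where
  "state_fm (Eq a b) \<longleftrightarrow> S_term a \<and> S_term b \<or> T_term a \<and> T_term b"
| "state_fm (Exp \<phi> a) \<longleftrightarrow> S_term a"
| "state_fm (Rel r a b) \<longleftrightarrow> S_term a \<and> S_term b"
| "state_fm Fls \<longleftrightarrow> True"
| "state_fm (And A B) \<longleftrightarrow> state_fm A \<and> state_fm B"
| "state_fm (Or A B) \<longleftrightarrow> state_fm A \<and> state_fm B"
| "state_fm (Imp A B) \<longleftrightarrow> state_fm A \<and> state_fm B"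
| "state_fm (All x \<tau> A) \<longleftrightarrow> False"
| "state_fm (Ex x \<tau> A) \<longleftrightarrow> False"

primrec sat :: "(nat \<Rightarrow> 's) \<Rightarrow> (nat \<Rightarrow> 't) \<Rightarrow> ('s, 't) fm \<Rightarrow> bool" where
  "sat e f (Eq a b) \<longleftrightarrow>
     (if S_term a then S_val e a = S_val e b else T_val e f a = T_val e f b)"
| "sat e f (Exp \<phi> a) \<longleftrightarrow> \<phi> (S_val e a)"
| "sat e f (Rel r a b) \<longleftrightarrow> (S_val e a, S_val e b) \<in> r"
| "sat e f Fls \<longleftrightarrow> False"
| "sat e f (And A B) \<longleftrightarrow> sat e f A \<and> sat e f B"
| "sat e f (Or A B) \<longleftrightarrow> sat e f A \<or> sat e f B"
| "sat e f (Imp A B) \<longleftrightarrow> (sat e f A \<longrightarrow> sat e f B)"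
| "sat e f (All x \<tau> A) \<longleftrightarrow> undefined"
| "sat e f (Ex x \<tau> A) \<longleftrightarrow> undefined"

definition signature :: "('s, 't) sig \<Rightarrow> bool" where
  "signature \<Sigma> \<longleftrightarrow>
     (\<forall>r \<in> Rels \<Sigma>. wf r) \<and>
     (\<forall>A \<in> state_axioms \<Sigma>. state_fm A \<and> (\<forall>e f. sat e f A))"

section \<open>Provability in WE-HA\<close>

inductive ax :: "('s, 't) sig \<Rightarrow> ('s, 't) fm \<Rightarrow> bool" for \<Sigma> :: "('s, 't) sig" where
  impK: "ax \<Sigma> (Imp A (Imp B A))"
| impS: "ax \<Sigma> (Imp (Imp A (Imp B C)) (Imp (Imp A B) (Imp A C)))"
| andI: "ax \<Sigma> (Imp A (Imp B (And A B)))"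
| andE1: "ax \<Sigma> (Imp (And A B) A)"
| andE2: "ax \<Sigma> (Imp (And A B) B)"
| orI1: "ax \<Sigma> (Imp A (Or A B))"
| orI2: "ax \<Sigma> (Imp B (Or A B))"
| orE: "ax \<Sigma> (Imp (Imp A C) (Imp (Imp B C) (Imp (Or A B) C)))"
| efq: "ax \<Sigma> (Imp Fls A)"
| allE: "wt \<Sigma> t \<Longrightarrow> ty_of t = \<tau> \<Longrightarrow> free_for t x \<tau> A \<Longrightarrow> ax \<Sigma> (Imp (All x \<tau> A) (fsubst x \<tau> t A))"
| exI: "wt \<Sigma> t \<Longrightarrow> ty_of t = \<tau> \<Longrightarrow> free_for t x \<tau> A \<Longrightarrow> ax \<Sigma> (Imp (fsubst x \<tau> t A) (Ex x \<tau> A))"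
  \<comment> \<open>equality at base types; compatibility with terms comes from the extensionality rule below\<close>
| refl: "ax \<Sigma> (Eq t t)"
| sym: "ax \<Sigma> (Imp (Eq t u) (Eq u t))"
| trans: "ax \<Sigma> (Imp (Eq t u) (Imp (Eq u v) (Eq t v)))"
| eq_Exp: "ax \<Sigma> (Imp (Eq t u) (Imp (Exp \<phi> t) (Exp \<phi> u)))"
| eq_Rel: "ax \<Sigma> (Imp (Eq t u) (Imp (Eq t' u') (Imp (Rel r t t') (Rel r u u'))))"
| Succ_Zero: "ax \<Sigma> (Neg (Eq (Succ \<cdot> t) Zero))"
| Succ_inj: "ax \<Sigma> (Imp (Eq (Succ \<cdot> t) (Succ \<cdot> u)) (Eq t u))"
| nat_induct: "free_for (Succ \<cdot> Var x N) x N A \<Longrightarrow>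
    ax \<Sigma> (Imp (fsubst x N Zero A)
         (Imp (All x N (Imp A (fsubst x N (Succ \<cdot> Var x N) A))) (All x N A)))"
| CombK: "ax \<Sigma> (CombK \<rho> \<tau> \<cdot> t \<cdot> u \<doteq> t)"
| CombS: "ax \<Sigma> (CombS \<rho> \<sigma> \<tau> \<cdot> t \<cdot> u \<cdot> v \<doteq> t \<cdot> v \<cdot> (u \<cdot> v))"
| Rec_Zero: "ax \<Sigma> (Rec \<rho> \<cdot> Zero \<cdot> u \<cdot> v \<doteq> u)"
| Rec_Succ: "ax \<Sigma> (Rec \<rho> \<cdot> (Succ \<cdot> t) \<cdot> u \<cdot> v \<doteq> v \<cdot> (Rec \<rho> \<cdot> t \<cdot> u \<cdot> v) \<cdot> t)"
| CaseEq_True: "ax \<Sigma> (Imp (Eq a b) (CaseEq \<beta> \<rho> \<cdot> a \<cdot> b \<cdot> u \<cdot> v \<doteq> u))"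
| CaseEq_False: "ax \<Sigma> (Imp (Neg (Eq a b)) (CaseEq \<beta> \<rho> \<cdot> a \<cdot> b \<cdot> u \<cdot> v \<doteq> v))"
| CaseExp_True: "ax \<Sigma> (Imp (Exp \<phi> a) (CaseExp \<phi> \<rho> \<cdot> a \<cdot> u \<cdot> v \<doteq> u))"
| CaseExp_False: "ax \<Sigma> (Imp (Neg (Exp \<phi> a)) (CaseExp \<phi> \<rho> \<cdot> a \<cdot> u \<cdot> v \<doteq> v))"
| CaseRel_True: "ax \<Sigma> (Imp (Rel r a b) (CaseRel r \<rho> \<cdot> a \<cdot> b \<cdot> u \<cdot> v \<doteq> u))"
| CaseRel_False: "ax \<Sigma> (Imp (Neg (Rel r a b)) (CaseRel r \<rho> \<cdot> a \<cdot> b \<cdot> u \<cdot> v \<doteq> v))"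
| dec_Eq: "ax \<Sigma> (Or (Eq a b) (Neg (Eq a b)))"
| dec_Exp: "ax \<Sigma> (Or (Exp \<phi> a) (Neg (Exp \<phi> a)))"
| dec_Rel: "ax \<Sigma> (Or (Rel r a b) (Neg (Rel r a b)))"
  \<comment> \<open>wellfoundedness enters the theory as transfinite induction over every formula\<close>
| wf_induct: "x \<noteq> y \<Longrightarrow> (y, S) \<notin> ffv A \<Longrightarrow> free_for (Var y S) x S A \<Longrightarrow>
    ax \<Sigma> (Imp (All x S (Imp (All y S (Imp (Rel r (Var y S) (Var x S)) (fsubst x S (Var y S) A))) A))
         (All x S A))"
| WRec: "ax \<Sigma> (Imp (Imp (Exp \<phi> s) (Rel r (a \<cdot> s) s))
    (WRec r \<phi> \<rho> \<cdot> a \<cdot> u \<cdot> F \<cdot> s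
       \<doteq> CaseExp \<phi> \<rho> \<cdot> s \<cdot> (F \<cdot> s \<cdot> (WRec r \<phi> \<rho> \<cdot> a \<cdot> u \<cdot> F \<cdot> (a \<cdot> s))) \<cdot> (u \<cdot> s)))"
  \<comment> \<open>the graphs of the primitives on named elements\<close>
| ground_S: "s \<noteq> s' \<Longrightarrow> ax \<Sigma> (Neg (Eq (StateS s) (StateS s')))"
| ground_T: "t \<noteq> t' \<Longrightarrow> ax \<Sigma> (Neg (Eq (StateT t) (StateT t')))"
| ground_Fwd: "ax \<Sigma> (Eq (Fwd c \<cdot> StateS s) (StateS (c s)))"
| ground_Bwd: "ax \<Sigma> (Eq (Bwd \<gamma> \<cdot> StateS s \<cdot> StateT t) (StateT (\<gamma> s t)))"
| ground_Exp_True: "\<phi> s \<Longrightarrow> ax \<Sigma> (Exp \<phi> (StateS s))"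
| ground_Exp_False: "\<not> \<phi> s \<Longrightarrow> ax \<Sigma> (Neg (Exp \<phi> (StateS s)))"
| ground_Rel_True: "(s', s) \<in> r \<Longrightarrow> ax \<Sigma> (Rel r (StateS s') (StateS s))"
| ground_Rel_False: "(s', s) \<notin> r \<Longrightarrow> ax \<Sigma> (Neg (Rel r (StateS s') (StateS s)))"
| state_axioms: "A \<in> state_axioms \<Sigma> \<Longrightarrow> ax \<Sigma> A"

text \<open>
  Typing side conditions on the axiom schemes are all imposed by requiring the instance to be
  well-formed. The last rule is the quantifier-free rule of extensionality.
\<close>

inductive provable :: "('s, 't) sig \<Rightarrow> ('s, 't) fm \<Rightarrow> bool" (infix "\<turnstile>" 50)
  for \<Sigma> :: "('s, 't) sig" where
  ax: "ax \<Sigma> A \<Longrightarrow> wff \<Sigma> A \<Longrightarrow> \<Sigma> \<turnstile> A"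
| mp: "\<Sigma> \<turnstile> Imp A B \<Longrightarrow> \<Sigma> \<turnstile> A \<Longrightarrow> \<Sigma> \<turnstile> B"
| allI: "\<Sigma> \<turnstile> Imp B A \<Longrightarrow> (x, \<tau>) \<notin> ffv B \<Longrightarrow> \<Sigma> \<turnstile> Imp B (All x \<tau> A)"
| exE: "\<Sigma> \<turnstile> Imp A B \<Longrightarrow> (x, \<tau>) \<notin> ffv B \<Longrightarrow> \<Sigma> \<turnstile> Imp (Ex x \<tau> A) B"
| qf_er: "qf A \<Longrightarrow> \<Sigma> \<turnstile> Imp A (t \<doteq> u) \<Longrightarrow> wt \<Sigma> v \<Longrightarrow>
    \<Sigma> \<turnstile> Imp A (tsubst x (ty_of t) t v \<doteq> tsubst x (ty_of t) u v)"

section \<open>Commands\<close>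

datatype (dead 's, dead 't) com =
    Skip
  | Prim "'s \<Rightarrow> 's" "'s \<Rightarrow> 't \<Rightarrow> 't"
  | Seq "('s, 't) com" "('s, 't) com"
  | Cond "'s \<Rightarrow> bool" "('s, 't) com" "('s, 't) com"
  | While "('s \<times> 's) set" "'s \<Rightarrow> bool" "('s, 't) com"

primrec command :: "('s, 't) sig \<Rightarrow> ('s, 't) com \<Rightarrow> bool" where
  "command \<Sigma> Skip \<longleftrightarrow> True"
| "command \<Sigma> (Prim c \<gamma>) \<longleftrightarrow> c \<in> Comm_plus \<Sigma> \<and> \<gamma> \<in> Comm_minus \<Sigma>"
| "command \<Sigma> (Seq C\<^sub>1 C\<^sub>2) \<longleftrightarrow> command \<Sigma> C\<^sub>1 \<and> command \<Sigma> C\<^sub>2"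
| "command \<Sigma> (Cond \<phi> C\<^sub>1 C\<^sub>2) \<longleftrightarrow> \<phi> \<in> Exps \<Sigma> \<and> command \<Sigma> C\<^sub>1 \<and> command \<Sigma> C\<^sub>2"
| "command \<Sigma> (While r \<phi> C) \<longleftrightarrow> r \<in> Rels \<Sigma> \<and> \<phi> \<in> Exps \<Sigma> \<and> command \<Sigma> C"

primrec subcommands :: "('s, 't) com \<Rightarrow> ('s, 't) com set" where
  "subcommands Skip = {Skip}"
| "subcommands (Prim c \<gamma>) = {Prim c \<gamma>}"
| "subcommands (Seq C\<^sub>1 C\<^sub>2) = {Seq C\<^sub>1 C\<^sub>2} \<union> subcommands C\<^sub>1 \<union> subcommands C\<^sub>2"
| "subcommands (Cond \<phi> C\<^sub>1 C\<^sub>2) = {Cond \<phi> C\<^sub>1 C\<^sub>2} \<union> subcommands C\<^sub>1 \<union> subcommands C\<^sub>2"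
| "subcommands (While r \<phi> C) = {While r \<phi> C} \<union> subcommands C"

text \<open>
  The denotations are closed terms, so the fixed variable names cannot be captured.
\<close>

primrec fwd :: "('s, 't) com \<Rightarrow> ('s, 't) trm" where
  "fwd Skip = lam 0 S (Var 0 S)"
| "fwd (Prim c \<gamma>) = Fwd c"
| "fwd (Seq C\<^sub>1 C\<^sub>2) = lam 0 S (fwd C\<^sub>2 \<cdot> (fwd C\<^sub>1 \<cdot> Var 0 S))"
| "fwd (Cond \<phi> C\<^sub>1 C\<^sub>2) =
     lam 0 S (CaseExp \<phi> S \<cdot> Var 0 S \<cdot> (fwd C\<^sub>1 \<cdot> Var 0 S) \<cdot> (fwd C\<^sub>2 \<cdot> Var 0 S))"
| "fwd (While r \<phi> C) =
     WRec r \<phi> S \<cdot> fwd C \<cdot> lam 0 S (Var 0 S) \<cdot> lam 0 S (lam 1 S (Var 1 S))"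

primrec bwd :: "('s, 't) com \<Rightarrow> ('s, 't) trm" where
  "bwd Skip = lam 0 S (lam 1 T (Var 1 T))"
| "bwd (Prim c \<gamma>) = Bwd \<gamma>"
| "bwd (Seq C\<^sub>1 C\<^sub>2) =
     lam 0 S (lam 1 T (bwd C\<^sub>1 \<cdot> Var 0 S \<cdot> (bwd C\<^sub>2 \<cdot> (fwd C\<^sub>1 \<cdot> Var 0 S) \<cdot> Var 1 T)))"
| "bwd (Cond \<phi> C\<^sub>1 C\<^sub>2) =
     lam 0 S (lam 1 T (CaseExp \<phi> T \<cdot> Var 0 S
       \<cdot> (bwd C\<^sub>1 \<cdot> Var 0 S \<cdot> Var 1 T) \<cdot> (bwd C\<^sub>2 \<cdot> Var 0 S \<cdot> Var 1 T)))"
| "bwd (While r \<phi> C) =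
     WRec r \<phi> (T \<rightarrow>\<^sub>t T) \<cdot> fwd C \<cdot> lam 0 S (lam 1 T (Var 1 T))
       \<cdot> lam 0 S (lam 1 (T \<rightarrow>\<^sub>t T) (lam 2 T (bwd C \<cdot> Var 0 S \<cdot> (Var 1 (T \<rightarrow>\<^sub>t T) \<cdot> Var 2 T))))"

section \<open>Operational semantics\<close>

inductive forward ::
  "'s \<times> ('s, 't) com \<Rightarrow> 's \<times> 's list \<times> ('s \<Rightarrow> 't \<Rightarrow> 't) list \<Rightarrow> bool" (infix "\<Down>" 50) where
  "(s, Skip) \<Down> (s, [], [])"
| "(s, Prim c \<gamma>) \<Down> (c s, [s], [\<gamma>])"
| "(s, C\<^sub>1) \<Down> (s', \<sigma>, \<Gamma>) \<Longrightarrow> (s', C\<^sub>2) \<Down> (s'', \<sigma>', \<Gamma>') \<Longrightarrow>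
     (s, Seq C\<^sub>1 C\<^sub>2) \<Down> (s'', \<sigma>' @ \<sigma>, \<Gamma>' @ \<Gamma>)"
| "\<phi> s \<Longrightarrow> (s, C\<^sub>1) \<Down> (s', \<sigma>, \<Gamma>) \<Longrightarrow> (s, Cond \<phi> C\<^sub>1 C\<^sub>2) \<Down> (s', \<sigma>, \<Gamma>)"
| "\<not> \<phi> s \<Longrightarrow> (s, C\<^sub>2) \<Down> (s', \<sigma>, \<Gamma>) \<Longrightarrow> (s, Cond \<phi> C\<^sub>1 C\<^sub>2) \<Down> (s', \<sigma>, \<Gamma>)"
| "\<phi> s \<Longrightarrow> (s, C) \<Down> (s', \<sigma>, \<Gamma>) \<Longrightarrow> (s', s) \<in> r \<Longrightarrow> (s', While r \<phi> C) \<Down> (s'', \<sigma>', \<Gamma>') \<Longrightarrow>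
     (s, While r \<phi> C) \<Down> (s'', \<sigma>' @ \<sigma>, \<Gamma>' @ \<Gamma>)"
| "\<not> \<phi> s \<Longrightarrow> (s, While r \<phi> C) \<Down> (s, [], [])"

inductive backward ::
  "'s list \<times> ('s \<Rightarrow> 't \<Rightarrow> 't) list \<times> 't \<Rightarrow> 's list \<times> ('s \<Rightarrow> 't \<Rightarrow> 't) list \<times> 't \<Rightarrow> bool"
  (infix "\<Rrightarrow>" 50) where
  "(\<sigma>, \<Gamma>, t) \<Rrightarrow> (\<sigma>, \<Gamma>, t)"
| "(s # \<sigma>, \<gamma> # \<Gamma>, t) \<Rrightarrow> (\<sigma>, \<Gamma>, \<gamma> s t)"
| "(\<sigma>, \<Gamma>, t) \<Rrightarrow> (\<sigma>', \<Gamma>', t') \<Longrightarrow> (\<sigma>', \<Gamma>', t') \<Rrightarrow> (\<sigma>'', \<Gamma>'', t'') \<Longrightarrow>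
     (\<sigma>, \<Gamma>, t) \<Rrightarrow> (\<sigma>'', \<Gamma>'', t'')"

end

theory Submission
  imports Defs
begin

text \<open>
  By induction on the command, the stacks of an execution reproduce the values of the denotations,
  and the equations for the denotations are provable because all state arguments are named elements,
  at which the theory decides \<open>\<phi>\<close> and computes the primitives. The only step beyond equational
  reasoning is termination of a loop: the hypothesis gives only a proof of \<open>s' \<prec> s\<close> in the theory, and
  \<open>s' \<prec> s\<close> itself follows because otherwise the theory would also refute it, and the theory is
  consistent. Consistency is shown with an extensional term model: each type \<open>\<tau>\<close> is interpreted by a
  partial equivalence relation on terms, defined by evaluation at base types and hereditarily at
  function types. (The full set-theoretic hierarchy over all finite types does not fit into one HOL type.)
\<close>

section \<open>Typing and simultaneous substitution\<close>

text \<open>Provability is internal to the theory, while \<open>forward\<close> asks for real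
  membership in \<open>r\<close>. Only one ground atom per iteration has to be reflected, and for
  this the absence of a proof of \<open>Fls\<close> suffices. The model must validate the
  extensionality rule, which exchanges provably equal functionals in every context, also inside
  arguments of recursors; a logical relation provides this through its fundamental lemma. Elements
  of the model are raw terms and a valuation is a simultaneous substitution, so no semantic domain
  has to be constructed. Evaluation is call by name: only base-type terms that a recursor, a case
  constant or a primitive inspects are evaluated, which is why evaluation and head reduction are
  defined together. Truth in the model is classical, which is harmless because nothing but
  consistency is read off from it.\<close>

primrec inst :: "(nat \<times> ty \<Rightarrow> ('s, 't) trm) \<Rightarrow> ('s, 't) trm \<Rightarrow> ('s, 't) trm" where
  "inst e (Var x \<tau>) = e (x, \<tau>)"
| "inst e (t \<cdot> u) = inst e t \<cdot> inst e u"
| "inst e Zero = Zero"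
| "inst e Succ = Succ"
| "inst e (CombK \<rho> \<tau>) = CombK \<rho> \<tau>"
| "inst e (CombS \<rho> \<sigma> \<tau>) = CombS \<rho> \<sigma> \<tau>"
| "inst e (Rec \<rho>) = Rec \<rho>"
| "inst e (CaseEq \<beta> \<rho>) = CaseEq \<beta> \<rho>"
| "inst e (CaseExp \<phi> \<rho>) = CaseExp \<phi> \<rho>"
| "inst e (CaseRel r \<rho>) = CaseRel r \<rho>"
| "inst e (WRec r \<phi> \<rho>) = WRec r \<phi> \<rho>"
| "inst e (StateS s) = StateS s"
| "inst e (StateT t) = StateT t"
| "inst e (Fwd c) = Fwd c"
| "inst e (Bwd \<gamma>) = Bwd \<gamma>"

lemma inst_cong: "(\<And>p. p \<in> fv t \<Longrightarrow> e p = e' p) \<Longrightarrow> inst e t = inst e' t"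
  by (induction t) auto

lemma inst_Var: "inst (\<lambda>(x, \<tau>). Var x \<tau>) t = t"
  by (induction t) auto

lemma inst_closed: "fv t = {} \<Longrightarrow> inst e t = t"
  using inst_cong[of t e "\<lambda>(x, \<tau>). Var x \<tau>"] by (simp add: inst_Var)

lemma inst_tsubst: "inst e (tsubst x \<rho> u t) = inst (e((x, \<rho>) := inst e u)) t"
  by (induction t) auto

lemma tsubst_inst: "tsubst x \<rho> u t = inst ((\<lambda>(y, \<tau>). Var y \<tau>)((x, \<rho>) := u)) t"
  by (induction t) auto

lemma tsubst_notin: "(x, \<rho>) \<notin> fv t \<Longrightarrow> tsubst x \<rho> u t = t"
  unfolding tsubst_inst by (subst (3) inst_Var[symmetric], rule inst_cong) auto

lemma fv_less_fresh: "(x, \<tau>) \<in> fv t \<Longrightarrow> x < fresh t"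
  by (induction t) (auto simp: less_max_iff_disj)

lemma fresh_notin_fv: "fresh t \<le> x \<Longrightarrow> (x, \<tau>) \<notin> fv t"
  using fv_less_fresh by (metis not_le)

text \<open>\<open>inst\<close> plays two roles. Inside the theory it is typed substitution and
  needs this condition. As a valuation of the model it is subject to \<open>good\<close> instead,
  under which the substituted terms may be ill-typed.\<close>

definition typed_env :: "('s, 't) sig \<Rightarrow> (nat \<times> ty \<Rightarrow> ('s, 't) trm) \<Rightarrow> bool" where
  "typed_env \<Sigma> e \<longleftrightarrow> (\<forall>x \<tau>. wt \<Sigma> (e (x, \<tau>)) \<and> ty_of (e (x, \<tau>)) = \<tau>)"

lemma typed_env_Var: "typed_env \<Sigma> (\<lambda>(x, \<tau>). Var x \<tau>)"
  by (simp add: typed_env_def)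

lemma typed_env_upd:
  "typed_env \<Sigma> e \<Longrightarrow> wt \<Sigma> u \<Longrightarrow> ty_of u = \<rho> \<Longrightarrow> typed_env \<Sigma> (e((x, \<rho>) := u))"
  by (simp add: typed_env_def)

lemma ty_of_inst: "typed_env \<Sigma> e \<Longrightarrow> ty_of (inst e t) = ty_of t"
  by (induction t) (auto simp: typed_env_def)

lemma wt_inst: "typed_env \<Sigma> e \<Longrightarrow> wt \<Sigma> t \<Longrightarrow> wt \<Sigma> (inst e t)"
proof (induction t)
  case (App t u)
  then show ?case by (auto simp: ty_of_inst)
qed (auto simp: typed_env_def)

lemma ty_of_tsubst: "wt \<Sigma> u \<Longrightarrow> ty_of u = \<rho> \<Longrightarrow> ty_of (tsubst x \<rho> u t) = ty_of t"
  unfolding tsubst_inst by (intro ty_of_inst typed_env_upd typed_env_Var)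

lemma wt_tsubst: "wt \<Sigma> u \<Longrightarrow> ty_of u = \<rho> \<Longrightarrow> wt \<Sigma> t \<Longrightarrow> wt \<Sigma> (tsubst x \<rho> u t)"
  unfolding tsubst_inst by (intro wt_inst typed_env_upd typed_env_Var)

lemma ty_of_lam: "ty_of (lam x \<rho> t) = \<rho> \<rightarrow>\<^sub>t ty_of t"
  by (cases t) auto

lemma wt_lam: "wt \<Sigma> t \<Longrightarrow> wt \<Sigma> (lam x \<rho> t)"
  by (induction t) (auto simp: ty_of_lam)

lemma fv_lam: "fv (lam x \<rho> t) = fv t - {(x, \<rho>)}"
  by (induction t) auto

text \<open>The recursion follows the type of \<open>t\<close> alone. The type of \<open>u\<close>
  is recovered from its well-typed applications to the fresh variables and, at the bottom, from the
  equal types in a base equation.\<close>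

lemma wff_eq_at:
  "wff \<Sigma> (eq_at \<tau> t u) \<Longrightarrow> ty_of t = \<tau> \<Longrightarrow> wt \<Sigma> t \<and> wt \<Sigma> u \<and> ty_of u = \<tau>"
  by (induction \<tau> t u rule: eq_at.induct) (auto simp: Let_def)

lemma wff_eqD: "wff \<Sigma> (t \<doteq> u) \<Longrightarrow> wt \<Sigma> t \<and> wt \<Sigma> u \<and> ty_of u = ty_of t"
  unfolding eq_def by (rule wff_eq_at) auto

lemma wff_eq_atI: "wt \<Sigma> t \<Longrightarrow> wt \<Sigma> u \<Longrightarrow> ty_of t = \<tau> \<Longrightarrow> ty_of u = \<tau> \<Longrightarrow> wff \<Sigma> (eq_at \<tau> t u)"
  by (induction \<tau> t u rule: eq_at.induct) (auto simp: Let_def base_def)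

lemma wff_eq_iff: "wff \<Sigma> (t \<doteq> u) \<longleftrightarrow> wt \<Sigma> t \<and> wt \<Sigma> u \<and> ty_of u = ty_of t"
  using wff_eqD wff_eq_atI unfolding eq_def by metis

lemma provable_wff: "\<Sigma> \<turnstile> A \<Longrightarrow> wff \<Sigma> A"
  by (induction rule: provable.induct) (auto simp: wff_eq_iff ty_of_tsubst wt_tsubst)

section \<open>Evaluation of terms\<close>

datatype (dead 's, dead 't) val = NV nat | SV 's | TV 't

text \<open>\<open>Rec\<close> may meet an argument whose value is a successor although it is not of
  the form \<open>Succ \<cdot> t\<close>. The predecessor passed on by \<open>red_Rec_Succ\<close>
  is then this canonical term.\<close>

primrec num :: "nat \<Rightarrow> ('s, 't) trm" where
  "num 0 = Zero"
| "num (Suc n) = Succ \<cdot> num n"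

text \<open>
  When the side condition of the \<open>WRec\<close> axiom fails, the recursor stops as if \<open>\<phi>\<close> were false, so
  that it is total on all arguments.
\<close>

inductive ev :: "('s, 't) trm \<Rightarrow> ('s, 't) val \<Rightarrow> bool"
  and red :: "('s, 't) trm \<Rightarrow> ('s, 't) trm \<Rightarrow> bool" where
  ev_Zero: "ev Zero (NV 0)"
| ev_Succ: "ev t (NV n) \<Longrightarrow> ev (Succ \<cdot> t) (NV (Suc n))"
| ev_StateS: "ev (StateS s) (SV s)"
| ev_StateT: "ev (StateT b) (TV b)"
| ev_Fwd: "ev t (SV s) \<Longrightarrow> ev (Fwd c \<cdot> t) (SV (c s))"
| ev_Bwd: "ev t (SV s) \<Longrightarrow> ev u (TV b) \<Longrightarrow> ev (Bwd \<gamma> \<cdot> t \<cdot> u) (TV (\<gamma> s b))"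
| ev_red: "red t t' \<Longrightarrow> ev t' v \<Longrightarrow> ev t v"
| red_App: "red t t' \<Longrightarrow> red (t \<cdot> u) (t' \<cdot> u)"
| red_K: "red (CombK \<rho> \<tau> \<cdot> t \<cdot> u) t"
| red_S: "red (CombS \<rho> \<sigma> \<tau> \<cdot> t \<cdot> u \<cdot> w) (t \<cdot> w \<cdot> (u \<cdot> w))"
| red_Rec_Zero: "ev n (NV 0) \<Longrightarrow> red (Rec \<rho> \<cdot> n \<cdot> t \<cdot> u) t"
| red_Rec_Succ: "ev n (NV (Suc m)) \<Longrightarrow>
    red (Rec \<rho> \<cdot> n \<cdot> t \<cdot> u) (u \<cdot> (Rec \<rho> \<cdot> num m \<cdot> t \<cdot> u) \<cdot> num m)"
| red_CaseEq: "ev a v \<Longrightarrow> ev b w \<Longrightarrow>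
    red (CaseEq \<beta> \<rho> \<cdot> a \<cdot> b \<cdot> t \<cdot> u) (if v = w then t else u)"
| red_CaseExp: "ev a (SV s) \<Longrightarrow> red (CaseExp \<phi> \<rho> \<cdot> a \<cdot> t \<cdot> u) (if \<phi> s then t else u)"
| red_CaseRel: "ev a (SV s) \<Longrightarrow> ev b (SV s') \<Longrightarrow>
    red (CaseRel r \<rho> \<cdot> a \<cdot> b \<cdot> t \<cdot> u) (if (s, s') \<in> r then t else u)"
| red_WRec: "ev b (SV s) \<Longrightarrow> ev (a \<cdot> b) (SV s') \<Longrightarrow>
    red (WRec r \<phi> \<rho> \<cdot> a \<cdot> t \<cdot> f \<cdot> b)
      (if \<phi> s \<and> (s', s) \<in> r then f \<cdot> b \<cdot> (WRec r \<phi> \<rho> \<cdot> a \<cdot> t \<cdot> f \<cdot> (a \<cdot> b)) else t \<cdot> b)"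

section \<open>Determinism of evaluation\<close>

inductive_cases red_AppE: "red (t \<cdot> u) z"
inductive_cases ev_AppE: "ev (t \<cdot> u) z"

lemma not_red_atom [simp]:
  "\<not> red Zero z" "\<not> red Succ z" "\<not> red (CombK \<rho> \<tau>) z" "\<not> red (CombS \<rho> \<sigma> \<tau>) z"
  "\<not> red (Rec \<rho>) z" "\<not> red (CaseEq \<beta> \<rho>) z" "\<not> red (CaseExp \<phi> \<rho>) z" "\<not> red (CaseRel r \<rho>) z"
  "\<not> red (WRec r \<phi> \<rho>) z" "\<not> red (StateS s) z" "\<not> red (StateT b) z" "\<not> red (Fwd c) z"
  "\<not> red (Bwd \<gamma>) z"
  by (auto elim: red.cases)

text \<open>Partial applications of the constants are stuck, so \<open>red_App\<close> never
  competes with a root rule. Likewise saturated \<open>Succ\<close>, \<open>Fwd\<close> and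
  \<open>Bwd\<close> do not reduce, so \<open>ev_red\<close> never competes with the rules that
  evaluate them.\<close>

lemma not_red_partial [simp]:
  "\<not> red (Succ \<cdot> t1) z" "\<not> red (CombK \<rho> \<tau> \<cdot> t1) z" "\<not> red (CombS \<rho> \<sigma> \<tau> \<cdot> t1) z"
  "\<not> red (CombS \<rho> \<sigma> \<tau> \<cdot> t1 \<cdot> t2) z" "\<not> red (Rec \<rho> \<cdot> t1) z" "\<not> red (Rec \<rho> \<cdot> t1 \<cdot> t2) z"
  "\<not> red (CaseEq \<beta> \<rho> \<cdot> t1) z" "\<not> red (CaseEq \<beta> \<rho> \<cdot> t1 \<cdot> t2) z"
  "\<not> red (CaseEq \<beta> \<rho> \<cdot> t1 \<cdot> t2 \<cdot> t3) z"
  "\<not> red (CaseExp \<phi> \<rho> \<cdot> t1) z" "\<not> red (CaseExp \<phi> \<rho> \<cdot> t1 \<cdot> t2) z"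
  "\<not> red (CaseRel r \<rho> \<cdot> t1) z" "\<not> red (CaseRel r \<rho> \<cdot> t1 \<cdot> t2) z"
  "\<not> red (CaseRel r \<rho> \<cdot> t1 \<cdot> t2 \<cdot> t3) z"
  "\<not> red (WRec r \<phi> \<rho> \<cdot> t1) z" "\<not> red (WRec r \<phi> \<rho> \<cdot> t1 \<cdot> t2) z"
  "\<not> red (WRec r \<phi> \<rho> \<cdot> t1 \<cdot> t2 \<cdot> t3) z"
  "\<not> red (Fwd c \<cdot> t1) z" "\<not> red (Bwd \<gamma> \<cdot> t1) z" "\<not> red (Bwd \<gamma> \<cdot> t1 \<cdot> t2) z"
  by (auto elim!: red_AppE)

text \<open>The head constant fixes the applicable rule, and the contractum depends only on the
  values of inspected arguments, which are unique by the simultaneous induction hypothesis.\<close>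

lemma ev_red_deterministic:
  "ev t v \<Longrightarrow> (\<forall>w. ev t w \<longrightarrow> v = w)"
  "red t t' \<Longrightarrow> (\<forall>t''. red t t'' \<longrightarrow> t' = t'')"
proof (induction rule: ev_red.inducts)
  case ev_Zero
  then show ?case by (auto elim: ev.cases)
next
  case (ev_Succ t n)
  then show ?case by (auto elim!: ev_AppE)
next
  case (ev_StateS s)
  then show ?case by (auto elim: ev.cases)
next
  case (ev_StateT b)
  then show ?case by (auto elim: ev.cases)
next
  case (ev_Fwd t s c)
  then show ?case by (auto elim!: ev_AppE)
next
  case (ev_Bwd t s u b \<gamma>)
  show ?case using ev_Bwd.IH by (auto elim!: ev_AppE)
next
  case (ev_red t t' v)
  show ?case
  proof (intro HOL.allI impI)
    fix w assume "ev t w"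
    then show "v = w" using ev_red.hyps(1) ev_red.IH by cases auto
  qed
next
  case (red_App t t' u)
  show ?case
  proof (intro HOL.allI impI)
    fix z assume "red (t \<cdot> u) z"
    then show "t' \<cdot> u = z" using red_App.hyps(1) red_App.IH by cases auto
  qed
next
  case (red_K \<rho> \<tau> t u)
  then show ?case by (auto elim!: red_AppE)
next
  case (red_S \<rho> \<sigma> \<tau> t u w)
  then show ?case by (auto elim!: red_AppE)
next
  case (red_Rec_Zero n \<rho> t u)
  show ?case by (intro HOL.allI impI, erule red_AppE) (use red_Rec_Zero.IH in auto)
next
  case (red_Rec_Succ n m \<rho> t u)
  show ?case by (intro HOL.allI impI, erule red_AppE) (use red_Rec_Succ.IH in auto)
next
  case (red_CaseEq a v b w \<beta> \<rho> t u)
  show ?case by (intro HOL.allI impI, erule red_AppE) (use red_CaseEq.IH in auto)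
next
  case (red_CaseExp a s \<phi> \<rho> t u)
  show ?case by (intro HOL.allI impI, erule red_AppE) (use red_CaseExp.IH in auto)
next
  case (red_CaseRel a s b s' r \<rho> t u)
  show ?case by (intro HOL.allI impI, erule red_AppE) (use red_CaseRel.IH in auto)
next
  case (red_WRec b s a s' r \<phi> \<rho> t f)
  show ?case by (intro HOL.allI impI, erule red_AppE) (use red_WRec.IH in auto)
qed

lemmas ev_unique = ev_red_deterministic(1)[rule_format]

lemma ev_num: "ev (num n) (NV n)"
  by (induction n) (auto intro: ev_Zero ev_Succ)

section \<open>An extensional term model\<close>

text \<open>A logical relation on raw terms without any typing condition. Its diagonal consists of
  the hereditarily total and extensional terms, and the elements of the model are its
  classes.\<close>

primrec per :: "ty \<Rightarrow> ('s, 't) trm \<Rightarrow> ('s, 't) trm \<Rightarrow> bool" where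
  "per N t u \<longleftrightarrow> (\<exists>n. ev t (NV n) \<and> ev u (NV n))"
| "per S t u \<longleftrightarrow> (\<exists>s. ev t (SV s) \<and> ev u (SV s))"
| "per T t u \<longleftrightarrow> (\<exists>b. ev t (TV b) \<and> ev u (TV b))"
| "per (\<rho> \<rightarrow>\<^sub>t \<tau>) t u \<longleftrightarrow> (\<forall>a b. per \<rho> a b \<longrightarrow> per \<tau> (t \<cdot> a) (u \<cdot> b))"

lemma per_sym: "per \<tau> t u \<Longrightarrow> per \<tau> u t"
  by (induction \<tau> arbitrary: t u) (simp_all, blast+)

lemma per_trans:
  fixes t u w :: "('s, 't) trm"
  shows "per \<tau> t u \<Longrightarrow> per \<tau> u w \<Longrightarrow> per \<tau> t w"
proof (induction \<tau> arbitrary: t u w)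
  case (Fun \<rho> \<tau>)
  show ?case unfolding per.simps
  proof (intro HOL.allI impI)
    fix a b :: "('s, 't) trm" assume "per \<rho> a b"
    moreover from this have "per \<rho> b b" using Fun.IH(1) per_sym by blast
    ultimately show "per \<tau> (t \<cdot> a) (w \<cdot> b)"
      using Fun.prems Fun.IH(2)[of "t \<cdot> a" "u \<cdot> b" "w \<cdot> b"] by auto
  qed
qed (auto dest: ev_unique)

text \<open>Closure under head expansion. At function types it works because \<open>red_App\<close>
  carries a head step through further arguments until a base type is reached, where
  \<open>ev_red\<close> applies.\<close>

lemma per_red: "red t t' \<Longrightarrow> per \<tau> t' u \<Longrightarrow> per \<tau> t u"
proof (induction \<tau> arbitrary: t t' u)
  case (Fun \<rho> \<tau>)
  then show ?case using red_App unfolding per.simps by blast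
qed (auto intro: ev_red)

lemma per_red2: "red t t' \<Longrightarrow> red u u' \<Longrightarrow> per \<tau> t' u' \<Longrightarrow> per \<tau> t u"
  by (meson per_red per_sym)

lemma per_App: "per (\<rho> \<rightarrow>\<^sub>t \<tau>) t t' \<Longrightarrow> per \<rho> u u' \<Longrightarrow> per \<tau> (t \<cdot> u) (t' \<cdot> u')"
  by simp

lemma per_FunI: "(\<And>a b. per \<rho> a b \<Longrightarrow> per \<tau> (t \<cdot> a) (u \<cdot> b)) \<Longrightarrow> per (\<rho> \<rightarrow>\<^sub>t \<tau>) t u"
  by simp

lemma per_baseD: "base \<tau> \<Longrightarrow> per \<tau> t u \<Longrightarrow> \<exists>v. ev t v \<and> ev u v"
  by (auto simp: base_def)

lemma per_base_iff: "base \<tau> \<Longrightarrow> per \<tau> t t \<Longrightarrow> per \<tau> t u \<longleftrightarrow> (\<exists>v. ev t v \<and> ev u v)"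
  by (auto simp: base_def) (metis ev_unique)+

text \<open>Needed for a \<open>good\<close> valuation to exist; without one, soundness would say
  nothing about \<open>Fls\<close>. Function types are inhabited by constant functions.\<close>

lemma per_inhabited: "\<exists>t :: ('s, 't) trm. per \<tau> t t"
proof (induction \<tau>)
  case (Fun \<rho> \<tau>)
  then obtain t :: "('s, 't) trm" where t: "per \<tau> t t" by blast
  have "per (\<rho> \<rightarrow>\<^sub>t \<tau>) (CombK \<tau> \<rho> \<cdot> t) (CombK \<tau> \<rho> \<cdot> t)"
    using per_red2[OF red_K red_K t] by auto
  then show ?case by blast
qed (auto intro: ev_Zero ev_StateS ev_StateT)

section \<open>Recursors, case constants and the fundamental lemma\<close>

lemma per_Rec:
  assumes "per \<rho> t t'" "per (\<rho> \<rightarrow>\<^sub>t N \<rightarrow>\<^sub>t \<rho>) u u'"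
  shows "ev n (NV k) \<Longrightarrow> ev n' (NV k) \<Longrightarrow> per \<rho> (Rec \<rho> \<cdot> n \<cdot> t \<cdot> u) (Rec \<rho> \<cdot> n' \<cdot> t' \<cdot> u')"
proof (induction k arbitrary: n n')
  case 0
  then show ?case using assms per_red2[OF red_Rec_Zero red_Rec_Zero] by blast
next
  case (Suc k)
  have "per \<rho> (u \<cdot> (Rec \<rho> \<cdot> num k \<cdot> t \<cdot> u) \<cdot> num k) (u' \<cdot> (Rec \<rho> \<cdot> num k \<cdot> t' \<cdot> u') \<cdot> num k)"
    using assms Suc.IH[OF ev_num ev_num] ev_num per.simps(1,4) by metis
  then show ?case using per_red2[OF red_Rec_Succ red_Rec_Succ] Suc.prems by blast
qed

text \<open>Wellfounded induction on the common value of the arguments \<open>b\<close> and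
  \<open>b'\<close>. Both sides take the same branch since the guard depends on values only, and the
  guard allows a recursive call only along \<open>r\<close>; hence \<open>a\<close> need not be
  descending.\<close>

lemma per_WRec:
  assumes "wf r" "per (S \<rightarrow>\<^sub>t S) a a'" "per (S \<rightarrow>\<^sub>t \<rho>) t t'" "per (S \<rightarrow>\<^sub>t \<rho> \<rightarrow>\<^sub>t \<rho>) f f'"
  shows "ev b (SV s) \<Longrightarrow> ev b' (SV s) \<Longrightarrow>
    per \<rho> (WRec r \<phi> \<rho> \<cdot> a \<cdot> t \<cdot> f \<cdot> b) (WRec r \<phi> \<rho> \<cdot> a' \<cdot> t' \<cdot> f' \<cdot> b')"
  using \<open>wf r\<close>
proof (induction s arbitrary: b b' rule: wf_induct_rule)
  case (less s)
  have b: "per S b b'" using less.prems by auto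
  with assms(2) obtain s' where s': "ev (a \<cdot> b) (SV s')" "ev (a' \<cdot> b') (SV s')" by fastforce
  show ?case
  proof (rule per_red2[OF red_WRec[OF less.prems(1) s'(1)] red_WRec[OF less.prems(2) s'(2)]], 
      cases "\<phi> s \<and> (s', s) \<in> r")
    case True
    then show "per \<rho>
       (if \<phi> s \<and> (s', s) \<in> r then f \<cdot> b \<cdot> (WRec r \<phi> \<rho> \<cdot> a \<cdot> t \<cdot> f \<cdot> (a \<cdot> b)) else t \<cdot> b)
       (if \<phi> s \<and> (s', s) \<in> r then f' \<cdot> b' \<cdot> (WRec r \<phi> \<rho> \<cdot> a' \<cdot> t' \<cdot> f' \<cdot> (a' \<cdot> b')) else t' \<cdot> b')"
      using assms(4) b less.IH[OF _ s'] by (simp del: per.simps(1-3))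
  next
    case False
    then show "per \<rho>
       (if \<phi> s \<and> (s', s) \<in> r then f \<cdot> b \<cdot> (WRec r \<phi> \<rho> \<cdot> a \<cdot> t \<cdot> f \<cdot> (a \<cdot> b)) else t \<cdot> b)
       (if \<phi> s \<and> (s', s) \<in> r then f' \<cdot> b' \<cdot> (WRec r \<phi> \<rho> \<cdot> a' \<cdot> t' \<cdot> f' \<cdot> (a' \<cdot> b')) else t' \<cdot> b')"
      using assms(3) b by (auto simp del: per.simps(1-3))
  qed
qed

lemma per_CaseEq:
  assumes "base \<beta>" "per \<beta> a a'" "per \<beta> b b'" "per \<rho> t t'" "per \<rho> u u'"
  shows "per \<rho> (CaseEq \<beta> \<rho> \<cdot> a \<cdot> b \<cdot> t \<cdot> u) (CaseEq \<beta> \<rho> \<cdot> a' \<cdot> b' \<cdot> t' \<cdot> u')"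
proof -
  obtain v where v: "ev a v" "ev a' v" using per_baseD[OF assms(1,2)] by blast
  obtain w where w: "ev b w" "ev b' w" using per_baseD[OF assms(1,3)] by blast
  show ?thesis
    by (rule per_red2[OF red_CaseEq[OF v(1) w(1)] red_CaseEq[OF v(2) w(2)]]) (use assms(4,5) in simp)
qed

text \<open>The fundamental lemma of the logical relation. With \<open>e = e'\<close> it says that
  well-typed terms denote elements of the model; with two valuations it says that they respect
  \<open>per\<close>, which is what the extensionality rule needs.\<close>

lemma per_inst:
  fixes e e' :: "nat \<times> ty \<Rightarrow> ('s, 't) trm"
  assumes "signature \<Sigma>" and "\<And>x \<tau>. per \<tau> (e (x, \<tau>)) (e' (x, \<tau>))"
  shows "wt \<Sigma> t \<Longrightarrow> per (ty_of t) (inst e t) (inst e' t)"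
proof (induction t)
  case (Var x \<tau>)
  then show ?case using assms(2) by simp
next
  case (App t u)
  then show ?case using per_App by auto
next
  case (CombK \<rho> \<tau>)
  show ?case unfolding ty_of.simps inst.simps
    by (intro per_FunI per_red2[OF red_K red_K])
next
  case (CombS \<rho> \<sigma> \<tau>)
  show ?case unfolding ty_of.simps inst.simps
    by (intro per_FunI per_red2[OF red_S red_S]) (metis per_App)
next
  case (Rec \<rho>)
  show ?case unfolding ty_of.simps inst.simps
    by (intro per_FunI) (metis per_Rec per.simps(1))
next
  case (CaseEq \<beta> \<rho>)
  then have "base \<beta>" by simp
  then show ?case unfolding ty_of.simps inst.simps
    by (intro per_FunI) (rule per_CaseEq)
next
  case (CaseExp \<phi> \<rho>)
  show ?case unfolding ty_of.simps inst.simps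
  proof (intro per_FunI)
    fix a a' b b' c c' :: "('s, 't) trm"
    assume "per S a a'" "per \<rho> b b'" "per \<rho> c c'"
    then show "per \<rho> (CaseExp \<phi> \<rho> \<cdot> a \<cdot> b \<cdot> c) (CaseExp \<phi> \<rho> \<cdot> a' \<cdot> b' \<cdot> c')"
      by (auto intro!: per_red2[OF red_CaseExp red_CaseExp] simp del: per.simps(4))
  qed
next
  case (CaseRel r \<rho>)
  show ?case unfolding ty_of.simps inst.simps
  proof (intro per_FunI)
    fix a a' b b' c c' d d' :: "('s, 't) trm"
    assume "per S a a'" "per S b b'" "per \<rho> c c'" "per \<rho> d d'"
    then show "per \<rho> (CaseRel r \<rho> \<cdot> a \<cdot> b \<cdot> c \<cdot> d) (CaseRel r \<rho> \<cdot> a' \<cdot> b' \<cdot> c' \<cdot> d')"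
      by (auto intro!: per_red2[OF red_CaseRel red_CaseRel] simp del: per.simps(4))
  qed
next
  case (WRec r \<phi> \<rho>)
  then have "wf r" using assms(1) by (auto simp: signature_def)
  then show ?case unfolding ty_of.simps inst.simps
    by (intro per_FunI) (metis per_WRec per.simps(2))
qed (auto intro: ev_Zero ev_Succ ev_StateS ev_StateT ev_Fwd ev_Bwd)

section \<open>Soundness and consistency\<close>

text \<open>Tarskian truth with quantifiers ranging over the diagonal of \<open>per\<close>. Atoms
  ask for values to exist, because an arbitrary valuation may produce terms without a value.\<close>

primrec holds :: "(nat \<times> ty \<Rightarrow> ('s, 't) trm) \<Rightarrow> ('s, 't) fm \<Rightarrow> bool" where
  "holds e (Eq t u) \<longleftrightarrow> (\<exists>v. ev (inst e t) v \<and> ev (inst e u) v)"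
| "holds e (Exp \<phi> t) \<longleftrightarrow> (\<exists>s. ev (inst e t) (SV s) \<and> \<phi> s)"
| "holds e (Rel r t u) \<longleftrightarrow> (\<exists>s s'. ev (inst e t) (SV s) \<and> ev (inst e u) (SV s') \<and> (s, s') \<in> r)"
| "holds e Fls \<longleftrightarrow> False"
| "holds e (And A B) \<longleftrightarrow> holds e A \<and> holds e B"
| "holds e (Or A B) \<longleftrightarrow> holds e A \<or> holds e B"
| "holds e (Imp A B) \<longleftrightarrow> (holds e A \<longrightarrow> holds e B)"
| "holds e (All x \<tau> A) \<longleftrightarrow> (\<forall>a. per \<tau> a a \<longrightarrow> holds (e((x, \<tau>) := a)) A)"
| "holds e (Ex x \<tau> A) \<longleftrightarrow> (\<exists>a. per \<tau> a a \<and> holds (e((x, \<tau>) := a)) A)"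

definition good :: "(nat \<times> ty \<Rightarrow> ('s, 't) trm) \<Rightarrow> bool" where
  "good e \<longleftrightarrow> (\<forall>x \<tau>. per \<tau> (e (x, \<tau>)) (e (x, \<tau>)))"

lemma good_upd: "good e \<Longrightarrow> per \<tau> a a \<Longrightarrow> good (e((x, \<tau>) := a))"
  by (simp add: good_def)

lemma good_inst: "signature \<Sigma> \<Longrightarrow> good e \<Longrightarrow> wt \<Sigma> t \<Longrightarrow> per (ty_of t) (inst e t) (inst e t)"
  by (rule per_inst) (auto simp: good_def)

lemma ex_good: "\<exists>e :: nat \<times> ty \<Rightarrow> ('s, 't) trm. good e"
proof -
  obtain g :: "ty \<Rightarrow> ('s, 't) trm" where "\<And>\<tau>. per \<tau> (g \<tau>) (g \<tau>)"
    using per_inhabited by metis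
  then have "good (g \<circ> snd)" by (simp add: good_def)
  then show ?thesis by blast
qed

lemma holds_cong: "(\<And>p. p \<in> ffv A \<Longrightarrow> e p = e' p) \<Longrightarrow> holds e A = holds e' A"
proof (induction A arbitrary: e e')
  case (All x \<tau> A)
  have "holds (e((x, \<tau>) := a)) A = holds (e'((x, \<tau>) := a)) A" for a
    by (rule All.IH) (use All.prems in auto)
  then show ?case by simp
next
  case (Ex x \<tau> A)
  have "holds (e((x, \<tau>) := a)) A = holds (e'((x, \<tau>) := a)) A" for a
    by (rule Ex.IH) (use Ex.prems in auto)
  then show ?case by simp
next
  case (And A B)
  show ?case using And.IH[of e e'] And.prems by simp
next
  case (Or A B)
  show ?case using Or.IH[of e e'] Or.prems by simp
next
  case (Imp A B)
  show ?case using Imp.IH[of e e'] Imp.prems by simp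
next
  case (Eq t u)
  then show ?case using inst_cong[of t e e'] inst_cong[of u e e'] by simp
next
  case (Exp \<phi> t)
  then show ?case using inst_cong[of t e e'] by simp
next
  case (Rel r t u)
  then show ?case using inst_cong[of t e e'] inst_cong[of u e e'] by simp
qed simp

lemma holds_upd_notin: "p \<notin> ffv A \<Longrightarrow> holds (e(p := a)) A = holds e A"
  by (rule holds_cong) auto

lemma fsubst_notin: "(x, \<rho>) \<notin> ffv A \<Longrightarrow> fsubst x \<rho> u A = A"
  by (induction A) (auto simp: tsubst_notin)

lemma holds_fsubst:
  "free_for u x \<rho> A \<Longrightarrow> holds e (fsubst x \<rho> u A) = holds (e((x, \<rho>) := inst e u)) A"
proof (induction A arbitrary: e)
  case (All y \<tau> A)
  show ?case
  proof (cases "(x, \<rho>) \<in> ffv (All y \<tau> A)")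
    case True
    then have *: "(x, \<rho>) \<noteq> (y, \<tau>)" "(y, \<tau>) \<notin> fv u" "free_for u x \<rho> A" using All.prems by auto
    have "inst (e((y, \<tau>) := a)) u = inst e u" for a
      by (rule inst_cong) (use * in auto)
    then have "holds (e((y, \<tau>) := a)) (fsubst x \<rho> u A) =
        holds (e((x, \<rho>) := inst e u, (y, \<tau>) := a)) A" for a
      using All.IH[OF *(3)] fun_upd_twist[OF *(1)] by metis
    then show ?thesis using *(1) by (auto simp del: fun_upd_apply)
  next
    case False
    then show ?thesis using fsubst_notin[OF False] holds_upd_notin[OF False] by metis
  qed
next
  case (Ex y \<tau> A)
  show ?case
  proof (cases "(x, \<rho>) \<in> ffv (Ex y \<tau> A)")
    case True
    then have *: "(x, \<rho>) \<noteq> (y, \<tau>)" "(y, \<tau>) \<notin> fv u" "free_for u x \<rho> A" using Ex.prems by auto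
    have "inst (e((y, \<tau>) := a)) u = inst e u" for a
      by (rule inst_cong) (use * in auto)
    then have "holds (e((y, \<tau>) := a)) (fsubst x \<rho> u A) =
        holds (e((x, \<rho>) := inst e u, (y, \<tau>) := a)) A" for a
      using Ex.IH[OF *(3)] fun_upd_twist[OF *(1)] by metis
    then show ?thesis using *(1) by (auto simp del: fun_upd_apply)
  next
    case False
    then show ?thesis using fsubst_notin[OF False] holds_upd_notin[OF False] by metis
  qed
qed (auto simp: inst_tsubst)

lemma ev_iff: "ev t v \<Longrightarrow> ev t w \<longleftrightarrow> w = v"
  by (metis ev_unique)

text \<open>Truth does not depend on the representatives of the classes. The induction axiom relies
  on this: its quantifier ranges over all terms with a numerical value, while induction reaches only
  the numerals.\<close>

lemma holds_per:
  fixes e e' :: "nat \<times> ty \<Rightarrow> ('s, 't) trm"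
  assumes "signature \<Sigma>"
  shows "wff \<Sigma> A \<Longrightarrow> (\<And>x \<tau>. per \<tau> (e (x, \<tau>)) (e' (x, \<tau>))) \<Longrightarrow> holds e A = holds e' A"
proof (induction A arbitrary: e e')
  case (Eq t u)
  note per = per_inst[where e = e and e' = e', OF assms Eq.prems(2)]
  from Eq have t: "base (ty_of t)" "wt \<Sigma> t" and u: "base (ty_of u)" "wt \<Sigma> u" by auto
  obtain v where v: "ev (inst e t) v" "ev (inst e' t) v"
    using per_baseD[OF t(1) per[OF t(2)]] by blast
  obtain w where w: "ev (inst e u) w" "ev (inst e' u) w"
    using per_baseD[OF u(1) per[OF u(2)]] by blast
  show ?case by (simp add: v[THEN ev_iff] w[THEN ev_iff])
next
  case (Exp \<phi> t)
  note per = per_inst[where e = e and e' = e', OF assms Exp.prems(2)]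
  obtain s where s: "ev (inst e t) (SV s)" "ev (inst e' t) (SV s)"
    using per[of t] Exp.prems(1) by auto
  show ?case by (simp add: s[THEN ev_iff])
next
  case (Rel r t u)
  note per = per_inst[where e = e and e' = e', OF assms Rel.prems(2)]
  obtain s where s: "ev (inst e t) (SV s)" "ev (inst e' t) (SV s)"
    using per[of t] Rel.prems(1) by auto
  obtain s' where s': "ev (inst e u) (SV s')" "ev (inst e' u) (SV s')"
    using per[of u] Rel.prems(1) by auto
  show ?case by (simp add: s[THEN ev_iff] s'[THEN ev_iff])
next
  case (All x \<tau> A)
  have "holds (e((x, \<tau>) := a)) A = holds (e'((x, \<tau>) := a)) A" if "per \<tau> a a" for a
    by (rule All.IH) (use All.prems that in auto)
  then show ?case by auto
next
  case (Ex x \<tau> A)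
  have "holds (e((x, \<tau>) := a)) A = holds (e'((x, \<tau>) := a)) A" if "per \<tau> a a" for a
    by (rule Ex.IH) (use Ex.prems that in auto)
  then show ?case by auto
next
  case (And A B)
  show ?case using And.IH[of e e'] And.prems by simp
next
  case (Or A B)
  show ?case using Or.IH[of e e'] Or.prems by simp
next
  case (Imp A B)
  show ?case using Imp.IH[of e e'] Imp.prems by simp
qed simp

lemma holds_upd_per:
  assumes "signature \<Sigma>" "wff \<Sigma> A" "good e" "per \<tau> a b"
  shows "holds (e((x, \<tau>) := a)) A = holds (e((x, \<tau>) := b)) A"
  by (rule holds_per[OF assms(1,2)]) (use assms(3,4) in \<open>auto simp: good_def\<close>)

text \<open>The formula compares \<open>t\<close> and \<open>u\<close> at the same argument,
  \<open>per\<close> at related arguments \<open>a\<close> and \<open>b\<close>. The gap closes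
  because \<open>t\<close> respects \<open>per\<close>: \<open>t \<cdot> a\<close> is related to
  \<open>t \<cdot> b\<close>, and this to \<open>u \<cdot> b\<close>.\<close>

lemma holds_eq_at:
  assumes "signature \<Sigma>"
  shows "wt \<Sigma> t \<Longrightarrow> wt \<Sigma> u \<Longrightarrow> ty_of t = \<tau> \<Longrightarrow> ty_of u = \<tau> \<Longrightarrow> good e \<Longrightarrow>
    holds e (eq_at \<tau> t u) \<longleftrightarrow> per \<tau> (inst e t) (inst e u)"
proof (induction \<tau> t u arbitrary: e rule: eq_at.induct)
  case (1 \<rho> \<tau> t u)
  define x where "x = max (fresh t) (fresh u)"
  have inst: "inst (e((x, \<rho>) := a)) t = inst e t" "inst (e((x, \<rho>) := a)) u = inst e u" for a
    by (auto intro!: inst_cong dest: fresh_notin_fv[rotated] simp: x_def)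
      (metis fresh_notin_fv max.cobounded1 max.cobounded2)+
  have "holds e (eq_at (\<rho> \<rightarrow>\<^sub>t \<tau>) t u) \<longleftrightarrow>
      (\<forall>a. per \<rho> a a \<longrightarrow> per \<tau> (inst e t \<cdot> a) (inst e u \<cdot> a))"
    using 1 by (auto simp: x_def[symmetric] Let_def inst good_upd)
  also have "\<dots> \<longleftrightarrow> per (\<rho> \<rightarrow>\<^sub>t \<tau>) (inst e t) (inst e u)"
  proof
    assume L: "\<forall>a. per \<rho> a a \<longrightarrow> per \<tau> (inst e t \<cdot> a) (inst e u \<cdot> a)"
    show "per (\<rho> \<rightarrow>\<^sub>t \<tau>) (inst e t) (inst e u)"
    proof (rule per_FunI)
      fix a b :: "('a, 'b) trm" assume "per \<rho> a b"
      moreover have "per (\<rho> \<rightarrow>\<^sub>t \<tau>) (inst e t) (inst e t)"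
        using good_inst[OF assms "1.prems"(5,1)] "1.prems"(3) by simp
      ultimately show "per \<tau> (inst e t \<cdot> a) (inst e u \<cdot> b)"
        using L per_App per_trans per_sym by metis
    qed
  qed auto
  finally show ?case .
qed (metis holds.simps(1) eq_at.simps(2-4) good_inst[OF assms] per_base_iff base_def)+

lemma holds_eq:
  assumes "signature \<Sigma>" "wff \<Sigma> (t \<doteq> u)" "good e"
  shows "holds e (t \<doteq> u) \<longleftrightarrow> per (ty_of t) (inst e t) (inst e u)"
  using holds_eq_at[OF assms(1)] wff_eqD[OF assms(2)] assms(3) unfolding eq_def by auto

lemma holds_eq_redI:
  assumes "signature \<Sigma>" "good e" "wff \<Sigma> (t \<doteq> u)" "red (inst e t) (inst e u)"
  shows "holds e (t \<doteq> u)"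
  unfolding holds_eq[OF assms(1,3,2)]
  using per_red[OF assms(4) good_inst[OF assms(1,2), of u]] wff_eqD[OF assms(3)] by simp

section \<open>State formulas in the model and in the given structure\<close>

lemma ev_S_term:
  assumes "\<And>x. ev (e (x, S)) (SV (g x))"
  shows "S_term a \<Longrightarrow> ev (inst e a) (SV (S_val g a))"
  using assms by (induction a rule: S_term.induct) (auto intro: ev_red.intros)

lemma ev_T_term:
  assumes "\<And>x. ev (e (x, S)) (SV (g x))" "\<And>x. ev (e (x, T)) (TV (h x))"
  shows "T_term a \<Longrightarrow> ev (inst e a) (TV (T_val g h a))"
  using assms(2) ev_S_term[where e = e and g = g, OF assms(1)]
  by (induction a rule: T_term.induct) (auto intro: ev_StateT ev_Bwd)

lemma S_T_term_disjoint: "S_term a \<Longrightarrow> \<not> T_term a"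
  by (cases a rule: S_term.cases) auto

lemma holds_state_fm:
  assumes g: "\<And>x. ev (e (x, S)) (SV (g x))" and h: "\<And>x. ev (e (x, T)) (TV (h x))"
  shows "state_fm A \<Longrightarrow> holds e A \<longleftrightarrow> sat g h A"
proof -
  note S = ev_S_term[where e = e and g = g, OF g]
    and T = ev_T_term[where e = e and g = g and h = h, OF g h]
  show "state_fm A \<Longrightarrow> holds e A \<longleftrightarrow> sat g h A"
  proof (induction A)
    case (Eq a b)
    then consider "S_term a" "S_term b" | "T_term a" "T_term b" "\<not> S_term a"
      using S_T_term_disjoint by auto
    then show ?case
    proof cases
      case 1
      then show ?thesis by (auto simp: S[THEN ev_iff])
    next
      case 2
      then show ?thesis by (auto simp: T[THEN ev_iff])
    qed
  next
    case (Exp \<phi> a)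
    then show ?case by (auto simp: S[THEN ev_iff])
  next
    case (Rel r a b)
    then show ?case by (auto simp: S[THEN ev_iff])
  qed auto
qed

section \<open>Validity of the axioms\<close>

lemma holds_ax:
  fixes e :: "nat \<times> ty \<Rightarrow> ('s, 't) trm"
  assumes sig: "signature \<Sigma>" and good: "good e"
  shows "ax \<Sigma> A \<Longrightarrow> wff \<Sigma> A \<Longrightarrow> holds e A"
proof (induction rule: ax.induct)
  case (allE t \<tau> x A)
  then show ?case
    using holds_fsubst[OF allE.hyps(3)] good_inst[OF sig good allE.hyps(1)] by auto
next
  case (exI t \<tau> x A)
  then show ?case
    using holds_fsubst[OF exI.hyps(3)] good_inst[OF sig good exI.hyps(1)] by auto
next
  case (refl t)
  then show ?case using good_inst[OF sig good, of t] per_baseD by simp blast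
next
  case (trans t u v)
  show ?case by auto (metis ev_unique)
next
  case (eq_Exp t u \<phi>)
  show ?case by auto (metis ev_unique)
next
  case (eq_Rel t u t' u' r)
  show ?case by auto (metis ev_unique)
next
  case (Succ_Zero t)
  then show ?case by (auto elim!: ev_AppE elim: ev.cases)
next
  case (Succ_inj t u)
  then show ?case by (auto elim!: ev_AppE)
next
  case (nat_induct x A)
  let ?P = "\<lambda>a. holds (e((x, N) := a)) A"
  have wff: "wff \<Sigma> A" using nat_induct by simp
  have step: "holds (e((x, N) := a)) (fsubst x N (Succ \<cdot> Var x N) A) \<longleftrightarrow> ?P (Succ \<cdot> a)" for a
    using holds_fsubst[OF nat_induct.hyps] by simp
  have zero: "holds e (fsubst x N Zero A) \<longleftrightarrow> ?P Zero"
  proof -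
    have "free_for Zero x N A" by (induction A) auto
    then show ?thesis using holds_fsubst by fastforce
  qed
  have ind: "?P a" if "?P Zero" "\<forall>a. per N a a \<longrightarrow> ?P a \<longrightarrow> ?P (Succ \<cdot> a)" and a: "per N a a" for a
  proof -
    have "?P (num n)" for n
      by (induction n) (use that ev_num in \<open>auto simp del: fun_upd_apply\<close>)
    \<comment> \<open>The term \<open>a\<close> need not be a numeral, but it is related to the
      numeral of its value.\<close>
    moreover obtain n where "ev a (NV n)" using a by auto
    then have "per N a (num n)" using ev_num by auto
    ultimately show "?P a" using holds_upd_per[OF sig wff good] by blast
  qed
  show ?case
    by (simp only: holds.simps(7,8) step zero) (intro impI HOL.allI, erule (2) ind)
next
  case (CombK \<rho> \<tau> t u)
  show ?case by (rule holds_eq_redI[OF sig good CombK.prems]) (simp add: red_K)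
next
  case (CombS \<rho> \<sigma> \<tau> t u v)
  show ?case by (rule holds_eq_redI[OF sig good CombS.prems]) (simp add: red_S)
next
  case (Rec_Zero \<rho> u v)
  show ?case
    by (rule holds_eq_redI[OF sig good Rec_Zero.prems]) (simp add: red_Rec_Zero ev_Zero)
next
  case (Rec_Succ \<rho> t u v)
  then have wt: "wt \<Sigma> t" "ty_of t = N" "wt \<Sigma> u" "ty_of u = \<rho>" "wt \<Sigma> v" "ty_of v = \<rho> \<rightarrow>\<^sub>t N \<rightarrow>\<^sub>t \<rho>"
    by (auto simp: wff_eq_iff)
  obtain m where m: "ev (inst e t) (NV m)" using good_inst[OF sig good wt(1)] wt(2) by auto
  have u: "per \<rho> (inst e u) (inst e u)" and v: "per (\<rho> \<rightarrow>\<^sub>t N \<rightarrow>\<^sub>t \<rho>) (inst e v) (inst e v)"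
    using good_inst[OF sig good wt(3)] good_inst[OF sig good wt(5)] wt by auto
  \<comment> \<open>The sides of the axiom are not one head step apart: the contractum contains
    \<open>num m\<close> where the axiom has \<open>t\<close>. The two terms are only
    related.\<close>
  have "per \<rho> (inst e v \<cdot> (Rec \<rho> \<cdot> num m \<cdot> inst e u \<cdot> inst e v) \<cdot> num m)
      (inst e v \<cdot> (Rec \<rho> \<cdot> inst e t \<cdot> inst e u \<cdot> inst e v) \<cdot> inst e t)"
    using per_App[OF per_App[OF v per_Rec[OF u v ev_num m]]] m ev_num by auto
  then show ?case unfolding holds_eq[OF sig Rec_Succ.prems good]
    by (auto simp del: per.simps intro!: per_red[OF red_Rec_Succ[OF ev_Succ[OF m]]])
next
  case (CaseEq_True a b \<beta> \<rho> u v)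
  then have wff: "wff \<Sigma> (CaseEq \<beta> \<rho> \<cdot> a \<cdot> b \<cdot> u \<cdot> v \<doteq> u)" by simp
  have "holds e (CaseEq \<beta> \<rho> \<cdot> a \<cdot> b \<cdot> u \<cdot> v \<doteq> u)" if "ev (inst e a) x" "ev (inst e b) x" for x
    by (rule holds_eq_redI[OF sig good wff]) (use red_CaseEq[OF that] in simp)
  then show ?case by auto
next
  case (CaseEq_False a b \<beta> \<rho> u v)
  then have wff: "wff \<Sigma> (CaseEq \<beta> \<rho> \<cdot> a \<cdot> b \<cdot> u \<cdot> v \<doteq> v)"
    and wt: "wt \<Sigma> a" "base (ty_of a)" "wt \<Sigma> b" "base (ty_of b)" by auto
  obtain x where x: "ev (inst e a) x"
    using per_baseD[OF wt(2) good_inst[OF sig good wt(1)]] by blast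
  obtain y where y: "ev (inst e b) y"
    using per_baseD[OF wt(4) good_inst[OF sig good wt(3)]] by blast
  have "holds e (CaseEq \<beta> \<rho> \<cdot> a \<cdot> b \<cdot> u \<cdot> v \<doteq> v)" if "x \<noteq> y"
    by (rule holds_eq_redI[OF sig good wff]) (use red_CaseEq[OF x y] that in simp)
  then show ?case using x y by auto
next
  case (CaseExp_True \<phi> a \<rho> u v)
  then have wff: "wff \<Sigma> (CaseExp \<phi> \<rho> \<cdot> a \<cdot> u \<cdot> v \<doteq> u)" by simp
  have "holds e (CaseExp \<phi> \<rho> \<cdot> a \<cdot> u \<cdot> v \<doteq> u)" if "ev (inst e a) (SV s)" "\<phi> s" for s
    by (rule holds_eq_redI[OF sig good wff])
      (use red_CaseExp[OF that(1), of \<phi>] that(2) in simp)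
  then show ?case by auto
next
  case (CaseExp_False \<phi> a \<rho> u v)
  then have wff: "wff \<Sigma> (CaseExp \<phi> \<rho> \<cdot> a \<cdot> u \<cdot> v \<doteq> v)"
    and wt: "wt \<Sigma> a" "ty_of a = S" by auto
  obtain s where s: "ev (inst e a) (SV s)"
    using good_inst[OF sig good wt(1)] wt(2) by auto
  have "holds e (CaseExp \<phi> \<rho> \<cdot> a \<cdot> u \<cdot> v \<doteq> v)" if "\<not> \<phi> s"
    by (rule holds_eq_redI[OF sig good wff]) (use red_CaseExp[OF s, of \<phi>] that in simp)
  then show ?case using s by auto
next
  case (CaseRel_True r a b \<rho> u v)
  then have wff: "wff \<Sigma> (CaseRel r \<rho> \<cdot> a \<cdot> b \<cdot> u \<cdot> v \<doteq> u)" by simp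
  have "holds e (CaseRel r \<rho> \<cdot> a \<cdot> b \<cdot> u \<cdot> v \<doteq> u)"
    if "ev (inst e a) (SV s)" "ev (inst e b) (SV s')" "(s, s') \<in> r" for s s'
    by (rule holds_eq_redI[OF sig good wff])
      (use red_CaseRel[OF that(1,2), of r] that(3) in simp)
  then show ?case by auto
next
  case (CaseRel_False r a b \<rho> u v)
  then have wff: "wff \<Sigma> (CaseRel r \<rho> \<cdot> a \<cdot> b \<cdot> u \<cdot> v \<doteq> v)"
    and wt: "wt \<Sigma> a" "ty_of a = S" "wt \<Sigma> b" "ty_of b = S" by auto
  obtain s where s: "ev (inst e a) (SV s)"
    using good_inst[OF sig good wt(1)] wt(2) by auto
  obtain s' where s': "ev (inst e b) (SV s')"
    using good_inst[OF sig good wt(3)] wt(4) by auto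
  have "holds e (CaseRel r \<rho> \<cdot> a \<cdot> b \<cdot> u \<cdot> v \<doteq> v)" if "(s, s') \<notin> r"
    by (rule holds_eq_redI[OF sig good wff]) (use red_CaseRel[OF s s', of r] that in simp)
  then show ?case using s s' by auto
next
  case (dec_Eq a b)
  show ?case unfolding holds.simps by blast
next
  case (dec_Exp \<phi> a)
  show ?case unfolding holds.simps by blast
next
  case (dec_Rel r a b)
  show ?case unfolding holds.simps by blast
next
  case (wf_induct x y A r)
  let ?P = "\<lambda>a. holds (e((x, S) := a)) A"
  have wff: "wff \<Sigma> A" and wf: "wf r" using wf_induct.prems sig by (auto simp: signature_def)
  have step: "holds (e((x, S) := a, (y, S) := b)) (fsubst x S (Var y S) A) \<longleftrightarrow> ?P b" for a b
  proof -
    have "holds (e((x, S) := a, (y, S) := b)) (fsubst x S (Var y S) A)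
        \<longleftrightarrow> holds (e((x, S) := a, (y, S) := b, (x, S) := b)) A"
      using holds_fsubst[OF wf_induct.hyps(3)] by simp
    also have "\<dots> \<longleftrightarrow> ?P b"
      using wf_induct.hyps(1,2) by (intro holds_cong) auto
    finally show ?thesis .
  qed
  have rel: "holds (e((x, S) := a, (y, S) := b)) (Rel r (Var y S) (Var x S)) \<longleftrightarrow>
      (\<exists>s s'. ev b (SV s) \<and> ev a (SV s') \<and> (s, s') \<in> r)" for a b
    using wf_induct.hyps(1) by simp
  have ind: "?P a" if H: "\<forall>a. per S a a \<longrightarrow>
      (\<forall>b. per S b b \<longrightarrow> (\<exists>s s'. ev b (SV s) \<and> ev a (SV s') \<and> (s, s') \<in> r) \<longrightarrow> ?P b) \<longrightarrow> ?P a"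
    and a: "per S a a" for a
  proof -
    \<comment> \<open>The induction runs over the state to which \<open>a\<close> evaluates and
      treats all terms with that value at once, since \<open>\<prec>\<close> lives on states and not
      on terms.\<close>
    obtain s where "ev a (SV s)" using a by auto
    with wf show "?P a"
    proof (induction s arbitrary: a rule: wf_induct_rule)
      case (less s)
      have "?P b" if "ev b (SV s'')" "ev a (SV s')" "(s'', s') \<in> r" for b s'' s'
        using less that by (metis ev_unique val.inject(2))
      then show ?case using H less.prems by (auto simp del: fun_upd_apply)
    qed
  qed
  show ?case
    by (simp only: holds.simps(7,8) step rel) (intro impI HOL.allI, erule (1) ind)
next
  case (WRec \<phi> s r a \<rho> u F)
  let ?W = "WRec r \<phi> \<rho> \<cdot> inst e a \<cdot> inst e u \<cdot> inst e F"
  let ?s = "inst e s"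
  let ?b = "inst e F \<cdot> ?s \<cdot> (?W \<cdot> (inst e a \<cdot> ?s))"
  have wff: "wff \<Sigma> (WRec r \<phi> \<rho> \<cdot> a \<cdot> u \<cdot> F \<cdot> s
       \<doteq> CaseExp \<phi> \<rho> \<cdot> s \<cdot> (F \<cdot> s \<cdot> (WRec r \<phi> \<rho> \<cdot> a \<cdot> u \<cdot> F \<cdot> (a \<cdot> s))) \<cdot> (u \<cdot> s))"
    using WRec.prems by simp
  have l: "wt \<Sigma> (WRec r \<phi> \<rho> \<cdot> a \<cdot> u \<cdot> F \<cdot> s)"
    and r: "wt \<Sigma> (CaseExp \<phi> \<rho> \<cdot> s \<cdot> (F \<cdot> s \<cdot> (WRec r \<phi> \<rho> \<cdot> a \<cdot> u \<cdot> F \<cdot> (a \<cdot> s))) \<cdot> (u \<cdot> s))"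
    using wff_eqD[OF wff] by blast+
  from r have wt: "wt \<Sigma> (F \<cdot> s \<cdot> (WRec r \<phi> \<rho> \<cdot> a \<cdot> u \<cdot> F \<cdot> (a \<cdot> s)))" "wt \<Sigma> (u \<cdot> s)"
    by (simp_all only: wt.simps)
  from l have ty: "ty_of s = S" "ty_of a = S \<rightarrow>\<^sub>t S" "ty_of u = S \<rightarrow>\<^sub>t \<rho>" "ty_of F = S \<rightarrow>\<^sub>t \<rho> \<rightarrow>\<^sub>t \<rho>"
    and wt_s: "wt \<Sigma> s" and wt_a: "wt \<Sigma> a" by auto
  have b: "per \<rho> ?b ?b" and us: "per \<rho> (inst e u \<cdot> ?s) (inst e u \<cdot> ?s)"
    using good_inst[OF sig good wt(1)] good_inst[OF sig good wt(2)] ty by auto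
  obtain x where x: "ev ?s (SV x)" using good_inst[OF sig good wt_s] ty by auto
  obtain y where y: "ev (inst e a \<cdot> ?s) (SV y)"
    using good_inst[OF sig good wt_a] ty x by fastforce
  \<comment> \<open>The premise of the axiom makes the guard
    \<open>\<phi> x \<and> (y, x) \<in> r\<close> equivalent to \<open>\<phi> x\<close>, so the
    recursor and the case term step to the same branch.\<close>
  have "per \<rho> (?W \<cdot> ?s) (CaseExp \<phi> \<rho> \<cdot> ?s \<cdot> ?b \<cdot> (inst e u \<cdot> ?s))" if "\<phi> x \<longrightarrow> (y, x) \<in> r"
    by (rule per_red2[OF red_WRec[OF x y] red_CaseExp[OF x]]) (use that b us in auto)
  then have "per \<rho> (?W \<cdot> ?s) (CaseExp \<phi> \<rho> \<cdot> ?s \<cdot> ?b \<cdot> (inst e u \<cdot> ?s))"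
    if "holds e (Imp (Exp \<phi> s) (Rel r (a \<cdot> s) s))"
    using that by (simp add: ev_iff[OF x] ev_iff[OF y])
  then show ?case by (simp add: holds_eq[OF sig wff good] del: per.simps)
next
  case (state_axioms A)
  have "per S (e (x, S)) (e (x, S))" "per T (e (x, T)) (e (x, T))" for x
    using good unfolding good_def by blast+
  then have "\<forall>x. \<exists>s. ev (e (x, S)) (SV s)" "\<forall>x. \<exists>b. ev (e (x, T)) (TV b)" by auto
  \<comment> \<open>The values of the substituted terms form a valuation in the given structure,
    where the state axioms are valid by assumption.\<close>
  then obtain g h where gh: "\<And>x. ev (e (x, S)) (SV (g x))" "\<And>x. ev (e (x, T)) (TV (h x))"
    by metis
  have "state_fm A" "sat g h A" using state_axioms.hyps sig by (auto simp: signature_def)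
  then show ?case using holds_state_fm[where e = e and g = g and h = h, OF gh] by blast
next
  case (ground_S s s')
  then show ?case by (simp add: ev_iff[OF ev_StateS])
next
  case (ground_T s s')
  then show ?case by (simp add: ev_iff[OF ev_StateT])
next
  case (ground_Fwd c s)
  show ?case by (simp add: ev_iff[OF ev_StateS] ev_Fwd ev_StateS)
next
  case (ground_Bwd \<gamma> s t)
  show ?case by (simp add: ev_iff[OF ev_StateT] ev_Bwd ev_StateS ev_StateT)
qed (auto simp: ev_iff[OF ev_StateS])

theorem soundness:
  fixes e :: "nat \<times> ty \<Rightarrow> ('s, 't) trm"
  assumes sig: "signature \<Sigma>"
  shows "\<Sigma> \<turnstile> A \<Longrightarrow> good e \<Longrightarrow> holds e A"
proof (induction arbitrary: e rule: provable.induct)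
  case (ax A)
  then show ?case using holds_ax[OF sig] by blast
next
  case (mp A B)
  then show ?case by simp
next
  case (allI B A x \<tau>)
  then show ?case by (auto simp: holds_upd_notin) (metis good_upd holds_upd_notin)
next
  case (exE A B x \<tau>)
  then show ?case by (auto simp: holds_upd_notin) (metis good_upd holds_upd_notin)
next
  case (qf_er A t u v x)
  \<comment> \<open>The conclusion is derived again only to obtain its well-formedness from
    \<open>provable_wff\<close>.\<close>
  have "\<Sigma> \<turnstile> Imp A (tsubst x (ty_of t) t v \<doteq> tsubst x (ty_of t) u v)"
    using qf_er.hyps by (rule provable.qf_er)
  then have wff: "wff \<Sigma> (tsubst x (ty_of t) t v \<doteq> tsubst x (ty_of t) u v)" "wff \<Sigma> (t \<doteq> u)"
    using provable_wff qf_er.hyps(2) by fastforce+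
  show ?case
  proof (simp, intro impI)
    assume "holds e A"
    then have "per (ty_of t) (inst e t) (inst e u)"
      using qf_er.IH[OF qf_er.prems] holds_eq[OF sig wff(2) qf_er.prems] by simp
    \<comment> \<open>The two valuations differ only at \<open>x\<close>, where they hold the
      related terms \<open>inst e t\<close> and \<open>inst e u\<close>.\<close>
    then have "per (ty_of v) (inst e (tsubst x (ty_of t) t v)) (inst e (tsubst x (ty_of t) u v))"
      unfolding inst_tsubst using qf_er.prems qf_er.hyps(3)
      by (intro per_inst[OF sig]) (auto simp: good_def)
    moreover have "ty_of (tsubst x (ty_of t) t v) = ty_of v"
      using wff_eqD[OF wff(2)] by (intro ty_of_tsubst) auto
    ultimately show "holds e (tsubst x (ty_of t) t v \<doteq> tsubst x (ty_of t) u v)"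
      using holds_eq[OF sig wff(1) qf_er.prems] by simp
  qed
qed

corollary consistent: "signature \<Sigma> \<Longrightarrow> \<not> \<Sigma> \<turnstile> Fls"
  using soundness ex_good holds.simps(4) by metis

section \<open>Equational reasoning in the theory\<close>

lemma provable_weaken: "\<Sigma> \<turnstile> A \<Longrightarrow> wff \<Sigma> B \<Longrightarrow> \<Sigma> \<turnstile> Imp B A"
  using provable.mp[OF provable.ax[OF ax.impK]] provable_wff by (metis wff.simps(7))

text \<open>A closed quantifier-free theorem, used as the dummy antecedent of \<open>allI\<close>
  and \<open>qf_er\<close>, which are stated under an implication.\<close>

lemma provable_Top: "\<Sigma> \<turnstile> Imp Fls Fls"
  by (simp add: provable.ax[OF ax.efq])

lemma provable_All: "\<Sigma> \<turnstile> A \<Longrightarrow> \<Sigma> \<turnstile> All x \<tau> A"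
  by (rule provable.mp[OF provable.allI[OF provable_weaken] provable_Top]) auto

lemma wff_fsubst: "wff \<Sigma> A \<Longrightarrow> wt \<Sigma> u \<Longrightarrow> ty_of u = \<rho> \<Longrightarrow> wff \<Sigma> (fsubst x \<rho> u A)"
  by (induction A) (auto simp: ty_of_tsubst wt_tsubst)

lemma provable_fsubst:
  assumes "\<Sigma> \<turnstile> All x \<tau> A" "wt \<Sigma> t" "ty_of t = \<tau>" "free_for t x \<tau> A"
  shows "\<Sigma> \<turnstile> fsubst x \<tau> t A"
proof (rule provable.mp[OF provable.ax[OF ax.allE] assms(1)])
  show "wff \<Sigma> (Imp (All x \<tau> A) (fsubst x \<tau> t A))"
    using provable_wff[OF assms(1)] wff_fsubst[OF _ assms(2,3)] by simp
qed (use assms in auto)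

lemma eqD: "\<Sigma> \<turnstile> t \<doteq> u \<Longrightarrow> wt \<Sigma> t \<and> wt \<Sigma> u \<and> ty_of u = ty_of t"
  by (rule wff_eqD[OF provable_wff])

lemma eq_tsubst:
  assumes "\<Sigma> \<turnstile> t \<doteq> u" "wt \<Sigma> v"
  shows "\<Sigma> \<turnstile> tsubst x (ty_of t) t v \<doteq> tsubst x (ty_of t) u v"
  by (rule provable.mp[OF provable.qf_er[OF _ provable_weaken[OF assms(1)] assms(2)] provable_Top])
    auto

lemma eq_fun_cong:
  assumes "\<Sigma> \<turnstile> t \<doteq> u" "ty_of t = \<rho> \<rightarrow>\<^sub>t \<tau>" "wt \<Sigma> a" "ty_of a = \<rho>"
  shows "\<Sigma> \<turnstile> t \<cdot> a \<doteq> u \<cdot> a"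
proof -
  \<comment> \<open>The context for the extensionality rule is a hole applied to \<open>a\<close>;
    the hole is a variable fresh for \<open>a\<close>, so substitution leaves \<open>a\<close>
    alone.\<close>
  have "tsubst (fresh a) (ty_of t) w (Var (fresh a) (ty_of t) \<cdot> a) = w \<cdot> a" for w
    by (simp add: tsubst_notin fresh_notin_fv)
  then show ?thesis
    using eq_tsubst[OF assms(1), of "Var (fresh a) (ty_of t) \<cdot> a" "fresh a"] assms by simp
qed

lemma eq_arg_cong:
  assumes "\<Sigma> \<turnstile> a \<doteq> b" "wt \<Sigma> t" "ty_of t = ty_of a \<rightarrow>\<^sub>t \<tau>"
  shows "\<Sigma> \<turnstile> t \<cdot> a \<doteq> t \<cdot> b"
proof -
  have "tsubst (fresh t) (ty_of a) w (t \<cdot> Var (fresh t) (ty_of a)) = t \<cdot> w" for w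
    by (simp add: tsubst_notin fresh_notin_fv)
  then show ?thesis
    using eq_tsubst[OF assms(1), of "t \<cdot> Var (fresh t) (ty_of a)" "fresh t"] assms by simp
qed

text \<open>Asking for the premise at every name \<open>x\<close> covers the particular fresh name
  chosen by \<open>eq_at\<close>.\<close>

lemma eq_ext:
  assumes "ty_of t = \<rho> \<rightarrow>\<^sub>t \<tau>" "\<And>x. \<Sigma> \<turnstile> t \<cdot> Var x \<rho> \<doteq> u \<cdot> Var x \<rho>"
  shows "\<Sigma> \<turnstile> t \<doteq> u"
  using provable_All[OF assms(2)] assms(1) by (simp add: eq_def Let_def)

lemma eq_base: "base (ty_of t) \<Longrightarrow> (t \<doteq> u) = Eq t u"
  by (auto simp: base_def eq_def)

lemma eq_base_refl: "base (ty_of t) \<Longrightarrow> wt \<Sigma> t \<Longrightarrow> \<Sigma> \<turnstile> t \<doteq> t"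
  by (simp add: eq_base provable.ax[OF ax.refl])

lemma eq_base_sym:
  assumes "base (ty_of t)" "\<Sigma> \<turnstile> t \<doteq> u"
  shows "\<Sigma> \<turnstile> u \<doteq> t"
proof -
  have "\<Sigma> \<turnstile> Eq u t"
    by (rule provable.mp[OF provable.ax[OF ax.sym]])
      (use assms eqD[OF assms(2)] in \<open>auto simp: eq_base\<close>)
  then show ?thesis using assms eqD[OF assms(2)] by (simp add: eq_base)
qed

lemma eq_base_trans:
  assumes "base (ty_of t)" "\<Sigma> \<turnstile> t \<doteq> u" "\<Sigma> \<turnstile> u \<doteq> w"
  shows "\<Sigma> \<turnstile> t \<doteq> w"
proof -
  note wt = eqD[OF assms(2)] eqD[OF assms(3)]
  have "\<Sigma> \<turnstile> Eq t u" "\<Sigma> \<turnstile> Eq u w" using assms wt by (simp_all add: eq_base)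
  then have "\<Sigma> \<turnstile> Eq t w"
    by (rule provable.mp[OF provable.mp[OF provable.ax[OF ax.trans]], rotated]) (use assms(1) wt in auto)
  then show ?thesis using assms(1) by (simp add: eq_base)
qed

text \<open>The equality axioms speak of base types only. This law, symmetry and transitivity are
  lifted by induction on the type: apply both sides to a variable, then use
  \<open>eq_ext\<close>.\<close>

lemma eq_refl: "wt \<Sigma> t \<Longrightarrow> \<Sigma> \<turnstile> t \<doteq> t"
proof (induction "ty_of t" arbitrary: t)
  case (Fun \<rho> \<tau>)
  note ty = Fun.hyps(3)[symmetric]
  have "\<Sigma> \<turnstile> t \<cdot> Var x \<rho> \<doteq> t \<cdot> Var x \<rho>" for x
    by (rule Fun.hyps(2)) (use Fun.prems ty in auto)
  then show ?case by (rule eq_ext[OF ty])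
qed (rule eq_base_refl; simp add: base_def)+

lemma eq_sym: "\<Sigma> \<turnstile> t \<doteq> u \<Longrightarrow> \<Sigma> \<turnstile> u \<doteq> t"
proof (induction "ty_of t" arbitrary: t u)
  case (Fun \<rho> \<tau>)
  note ty = Fun.hyps(3)[symmetric] and tu = eqD[OF Fun.prems]
  have "\<Sigma> \<turnstile> u \<cdot> Var x \<rho> \<doteq> t \<cdot> Var x \<rho>" for x
    by (rule Fun.hyps(2)[OF _ eq_fun_cong[OF Fun.prems ty]]) (simp_all add: ty)
  then show ?case by (rule eq_ext[rotated]) (simp add: tu ty)
qed (rule eq_base_sym; simp add: base_def)+

lemma eq_trans [trans]: "\<Sigma> \<turnstile> t \<doteq> u \<Longrightarrow> \<Sigma> \<turnstile> u \<doteq> w \<Longrightarrow> \<Sigma> \<turnstile> t \<doteq> w"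
proof (induction "ty_of t" arbitrary: t u w)
  case (Fun \<rho> \<tau>)
  note ty = Fun.hyps(3)[symmetric] and tu = eqD[OF Fun.prems(1)]
  have "\<Sigma> \<turnstile> t \<cdot> Var x \<rho> \<doteq> w \<cdot> Var x \<rho>" for x
    by (rule Fun.hyps(2)[OF _ eq_fun_cong[OF Fun.prems(1) ty] eq_fun_cong[OF Fun.prems(2)]])
      (simp_all add: tu ty)
  then show ?case by (rule eq_ext[OF ty])
qed (rule eq_base_trans; simp add: base_def)+

lemma eq_App:
  assumes "\<Sigma> \<turnstile> t \<doteq> u" "\<Sigma> \<turnstile> a \<doteq> b" "ty_of t = ty_of a \<rightarrow>\<^sub>t \<tau>"
  shows "\<Sigma> \<turnstile> t \<cdot> a \<doteq> u \<cdot> b"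
  using eq_trans[OF eq_fun_cong[OF assms(1,3)] eq_arg_cong[OF assms(2)]] eqD[OF assms(1)]
    eqD[OF assms(2)] assms(3) by auto

section \<open>Combinator equations and beta conversion\<close>

lemma eq_CombK: "wt \<Sigma> t \<Longrightarrow> wt \<Sigma> u \<Longrightarrow> \<Sigma> \<turnstile> CombK (ty_of t) (ty_of u) \<cdot> t \<cdot> u \<doteq> t"
  by (rule provable.ax[OF ax.CombK]) (auto simp: wff_eq_iff)

lemma eq_CombS:
  assumes "wt \<Sigma> t" "wt \<Sigma> u" "wt \<Sigma> v" "ty_of t = ty_of v \<rightarrow>\<^sub>t \<sigma> \<rightarrow>\<^sub>t \<tau>" "ty_of u = ty_of v \<rightarrow>\<^sub>t \<sigma>"
  shows "\<Sigma> \<turnstile> CombS (ty_of v) \<sigma> \<tau> \<cdot> t \<cdot> u \<cdot> v \<doteq> t \<cdot> v \<cdot> (u \<cdot> v)"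
  by (rule provable.ax[OF ax.CombS]) (use assms in \<open>auto simp: wff_eq_iff\<close>)

text \<open>
  Bracket abstraction does not commute with substitution syntactically (\<open>lam\<close> treats a variable and
  a compound closed term differently), so the environment is kept around the abstraction.
\<close>

lemma beta:
  assumes e: "typed_env \<Sigma> e" and b: "wt \<Sigma> b" "ty_of b = \<sigma>"
  shows "wt \<Sigma> t \<Longrightarrow> \<Sigma> \<turnstile> inst e (lam y \<sigma> t) \<cdot> b \<doteq> inst (e((y, \<sigma>) := b)) t"
proof (induction t)
  case (Var x \<tau>)
  show ?case
  proof (cases "(x, \<tau>) = (y, \<sigma>)")
    case True
    have "\<Sigma> \<turnstile> CombS \<sigma> (\<sigma> \<rightarrow>\<^sub>t \<sigma>) \<sigma> \<cdot> CombK \<sigma> (\<sigma> \<rightarrow>\<^sub>t \<sigma>) \<cdot> CombK \<sigma> \<sigma> \<cdot> b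
        \<doteq> CombK \<sigma> (\<sigma> \<rightarrow>\<^sub>t \<sigma>) \<cdot> b \<cdot> (CombK \<sigma> \<sigma> \<cdot> b)"
      using eq_CombS[of \<Sigma> "CombK \<sigma> (\<sigma> \<rightarrow>\<^sub>t \<sigma>)" "CombK \<sigma> \<sigma>" b "\<sigma> \<rightarrow>\<^sub>t \<sigma>" \<sigma>] b by simp
    also have "\<Sigma> \<turnstile> CombK \<sigma> (\<sigma> \<rightarrow>\<^sub>t \<sigma>) \<cdot> b \<cdot> (CombK \<sigma> \<sigma> \<cdot> b) \<doteq> b"
      using eq_CombK[of \<Sigma> b "CombK \<sigma> \<sigma> \<cdot> b"] b by simp
    finally show ?thesis using True by simp
  next
    case False
    then show ?thesis using eq_CombK[of \<Sigma> "e (x, \<tau>)" b] e b by (auto simp: typed_env_def)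
  qed
next
  case (App t u)
  define e' where "e' = e((y, \<sigma>) := b)"
  from App.prems obtain \<tau> where wt: "wt \<Sigma> t" "wt \<Sigma> u" and ty: "ty_of t = ty_of u \<rightarrow>\<^sub>t \<tau>" by auto
  have lam: "wt \<Sigma> (inst e (lam y \<sigma> w))" "ty_of (inst e (lam y \<sigma> w)) = \<sigma> \<rightarrow>\<^sub>t ty_of w"
    if "wt \<Sigma> w" for w
    using that by (simp_all add: wt_inst[OF e] ty_of_inst[OF e] wt_lam ty_of_lam)
  have "\<Sigma> \<turnstile> inst e (lam y \<sigma> (t \<cdot> u)) \<cdot> b \<doteq> inst e (lam y \<sigma> t) \<cdot> b \<cdot> (inst e (lam y \<sigma> u) \<cdot> b)"
    using eq_CombS[of \<Sigma> "inst e (lam y \<sigma> t)" "inst e (lam y \<sigma> u)" b "ty_of u" \<tau>]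
    using lam wt ty b by simp
  also have "\<Sigma> \<turnstile> inst e (lam y \<sigma> t) \<cdot> b \<cdot> (inst e (lam y \<sigma> u) \<cdot> b) \<doteq> inst e' t \<cdot> inst e' u"
    unfolding e'_def
    by (rule eq_App[OF App.IH(1)[OF wt(1)] App.IH(2)[OF wt(2)]]) (simp add: lam wt ty)
  finally show ?case by (simp add: e'_def del: fun_upd_apply)
qed (use eq_CombK[OF _ b(1)] b(2) in fastforce)+

lemma beta2:
  assumes e: "typed_env \<Sigma> e" and a: "wt \<Sigma> a" "ty_of a = \<rho>" and b: "wt \<Sigma> b" "ty_of b = \<sigma>"
    and t: "wt \<Sigma> t"
  shows "\<Sigma> \<turnstile> inst e (lam x \<rho> (lam y \<sigma> t)) \<cdot> a \<cdot> b \<doteq> inst (e((x, \<rho>) := a, (y, \<sigma>) := b)) t"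
proof -
  have "\<Sigma> \<turnstile> inst e (lam x \<rho> (lam y \<sigma> t)) \<cdot> a \<cdot> b \<doteq> inst (e((x, \<rho>) := a)) (lam y \<sigma> t) \<cdot> b"
    by (rule eq_fun_cong[OF beta[OF e a wt_lam[OF t]] _ b])
      (simp add: ty_of_inst[OF e] ty_of_lam wt_lam t del: lam.simps)
  also note beta[OF typed_env_upd[OF e a] b t]
  finally show ?thesis .
qed

lemma beta3:
  assumes e: "typed_env \<Sigma> e" and a: "wt \<Sigma> a" "ty_of a = \<rho>" and b: "wt \<Sigma> b" "ty_of b = \<sigma>"
    and c: "wt \<Sigma> c" "ty_of c = \<tau>" and t: "wt \<Sigma> t"
  shows "\<Sigma> \<turnstile> inst e (lam x \<rho> (lam y \<sigma> (lam z \<tau> t))) \<cdot> a \<cdot> b \<cdot> c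
    \<doteq> inst (e((x, \<rho>) := a, (y, \<sigma>) := b, (z, \<tau>) := c)) t"
proof -
  have "\<Sigma> \<turnstile> inst e (lam x \<rho> (lam y \<sigma> (lam z \<tau> t))) \<cdot> a \<cdot> b \<cdot> c
      \<doteq> inst (e((x, \<rho>) := a, (y, \<sigma>) := b)) (lam z \<tau> t) \<cdot> c"
    by (rule eq_fun_cong[OF beta2[OF e a b wt_lam[OF t]] _ c])
      (simp add: ty_of_inst[OF e] ty_of_lam wt_lam t del: lam.simps)
  also note beta[OF typed_env_upd[OF typed_env_upd[OF e a] b] c t]
  finally show ?thesis .
qed

lemmas beta_closed = beta[OF typed_env_Var, unfolded inst_Var]
  and beta2_closed = beta2[OF typed_env_Var, unfolded inst_Var]
  and beta3_closed = beta3[OF typed_env_Var, unfolded inst_Var]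

section \<open>Computation at named states\<close>

lemma eq_CaseExp:
  assumes "\<phi> \<in> Exps \<Sigma>" "wt \<Sigma> u" "wt \<Sigma> v" "ty_of u = \<rho>" "ty_of v = \<rho>"
  shows "\<Sigma> \<turnstile> CaseExp \<phi> \<rho> \<cdot> StateS s \<cdot> u \<cdot> v \<doteq> (if \<phi> s then u else v)"
proof (cases "\<phi> s")
  case True
  have "\<Sigma> \<turnstile> CaseExp \<phi> \<rho> \<cdot> StateS s \<cdot> u \<cdot> v \<doteq> u"
    by (rule provable.mp[OF provable.ax[OF ax.CaseExp_True]
          provable.ax[OF ax.ground_Exp_True[of \<phi>, OF True]]]) (use assms in \<open>auto simp: wff_eq_iff\<close>)
  then show ?thesis using True by simp
next
  case False
  have "\<Sigma> \<turnstile> CaseExp \<phi> \<rho> \<cdot> StateS s \<cdot> u \<cdot> v \<doteq> v"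
    by (rule provable.mp[OF provable.ax[OF ax.CaseExp_False]
          provable.ax[OF ax.ground_Exp_False[of \<phi>, OF False]]]) (use assms in \<open>auto simp: wff_eq_iff\<close>)
  then show ?thesis using False by simp
qed

text \<open>The branch is decided and the next state is computed, so a recursor at a named state
  unfolds to one at a named state. This lets the unfolding be iterated along an execution.\<close>

lemma eq_WRec:
  assumes dec: "\<Sigma> \<turnstile> Imp (Exp \<phi> (StateS s)) (Rel r (a \<cdot> StateS s) (StateS s))"
    and a: "\<Sigma> \<turnstile> a \<cdot> StateS s \<doteq> StateS s'" "ty_of a = S \<rightarrow>\<^sub>t S"
    and u: "wt \<Sigma> u" "ty_of u = S \<rightarrow>\<^sub>t \<rho>"
    and F: "wt \<Sigma> F" "ty_of F = S \<rightarrow>\<^sub>t \<rho> \<rightarrow>\<^sub>t \<rho>"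
  defines "W \<equiv> WRec r \<phi> \<rho> \<cdot> a \<cdot> u \<cdot> F"
  shows "\<Sigma> \<turnstile> W \<cdot> StateS s \<doteq> (if \<phi> s then F \<cdot> StateS s \<cdot> (W \<cdot> StateS s') else u \<cdot> StateS s)"
proof -
  have wt: "\<phi> \<in> Exps \<Sigma>" "r \<in> Rels \<Sigma>" "wt \<Sigma> a"
    using provable_wff[OF dec] by auto
  have W: "wt \<Sigma> W" "ty_of W = S \<rightarrow>\<^sub>t \<rho>" using wt a(2) u F by (auto simp: W_def)
  have "\<Sigma> \<turnstile> W \<cdot> StateS s \<doteq> CaseExp \<phi> \<rho> \<cdot> StateS s
      \<cdot> (F \<cdot> StateS s \<cdot> (W \<cdot> (a \<cdot> StateS s))) \<cdot> (u \<cdot> StateS s)"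
    unfolding W_def
    by (rule provable.mp[OF provable.ax[OF ax.WRec] dec])
      (use wt a(2) u F in \<open>auto simp: wff_eq_iff\<close>)
  also have "\<Sigma> \<turnstile> CaseExp \<phi> \<rho> \<cdot> StateS s
      \<cdot> (F \<cdot> StateS s \<cdot> (W \<cdot> (a \<cdot> StateS s))) \<cdot> (u \<cdot> StateS s)
      \<doteq> (if \<phi> s then F \<cdot> StateS s \<cdot> (W \<cdot> (a \<cdot> StateS s)) else u \<cdot> StateS s)"
    by (rule eq_CaseExp) (use wt a(2) u F W in auto)
  also have "\<Sigma> \<turnstile> (if \<phi> s then F \<cdot> StateS s \<cdot> (W \<cdot> (a \<cdot> StateS s)) else u \<cdot> StateS s)
      \<doteq> (if \<phi> s then F \<cdot> StateS s \<cdot> (W \<cdot> StateS s') else u \<cdot> StateS s)"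
  proof (cases "\<phi> s")
    case True
    have "\<Sigma> \<turnstile> F \<cdot> StateS s \<cdot> (W \<cdot> (a \<cdot> StateS s)) \<doteq> F \<cdot> StateS s \<cdot> (W \<cdot> StateS s')"
      by (intro eq_arg_cong a) (use W F a(2) in auto)
    then show ?thesis using True by simp
  next
    case False
    then show ?thesis using eq_refl[of \<Sigma> "u \<cdot> StateS s"] u by simp
  qed
  finally show ?thesis .
qed

section \<open>Denotations and execution\<close>

lemma fv_fwd [simp]: "fv (fwd C) = {}"
  by (induction C) (auto simp: fv_lam)

lemma fv_bwd [simp]: "fv (bwd C) = {}"
  by (induction C) (auto simp: fv_lam)

lemma wt_fwd: "command \<Sigma> C \<Longrightarrow> wt \<Sigma> (fwd C) \<and> ty_of (fwd C) = S \<rightarrow>\<^sub>t S"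
  by (induction C) (auto simp del: lam.simps simp: wt_lam ty_of_lam)

lemma wt_bwd: "command \<Sigma> C \<Longrightarrow> wt \<Sigma> (bwd C) \<and> ty_of (bwd C) = S \<rightarrow>\<^sub>t T \<rightarrow>\<^sub>t T"
  by (induction C) (auto simp del: lam.simps simp: wt_lam ty_of_lam wt_fwd)

text \<open>Equations point towards named elements so that they chain by transitivity. The witness
  \<open>t'\<close> is chosen before the rest of the stacks, uniformly in
  \<open>\<sigma>\<^sub>0\<close> and \<open>\<Gamma>\<^sub>0\<close>, which makes backward runs
  composable.\<close>

definition simulates where
  "simulates \<Sigma> C s s' \<sigma> \<Gamma> \<longleftrightarrow>
    (s, C) \<Down> (s', \<sigma>, \<Gamma>) \<and>
    \<Sigma> \<turnstile> fwd C \<cdot> StateS s \<doteq> StateS s' \<and>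
    (\<forall>t. \<exists>t'. (\<forall>\<sigma>\<^sub>0 \<Gamma>\<^sub>0. (\<sigma> @ \<sigma>\<^sub>0, \<Gamma> @ \<Gamma>\<^sub>0, t) \<Rrightarrow> (\<sigma>\<^sub>0, \<Gamma>\<^sub>0, t')) \<and>
      \<Sigma> \<turnstile> bwd C \<cdot> StateS s \<cdot> StateT t \<doteq> StateT t')"

section \<open>Simulation for each form of command\<close>

lemma simulates_Skip: "simulates \<Sigma> Skip s s [] []"
proof -
  have "\<Sigma> \<turnstile> fwd Skip \<cdot> StateS s \<doteq> StateS s"
    using beta_closed[of \<Sigma> "StateS s" S "Var 0 S" 0] by (simp del: lam.simps)
  moreover have "\<Sigma> \<turnstile> bwd Skip \<cdot> StateS s \<cdot> StateT t \<doteq> StateT t" for t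
    using beta2_closed[of \<Sigma> "StateS s" S "StateT t" T "Var 1 T" 0 1] by (simp del: lam.simps)
  ultimately show ?thesis
    unfolding simulates_def by (auto intro: forward.intros backward.intros)
qed

lemma simulates_Prim:
  assumes "c \<in> Comm_plus \<Sigma>" "\<gamma> \<in> Comm_minus \<Sigma>"
  shows "simulates \<Sigma> (Prim c \<gamma>) s (c s) [s] [\<gamma>]"
proof -
  have "\<Sigma> \<turnstile> Fwd c \<cdot> StateS s \<doteq> StateS (c s)"
    using assms by (auto simp: eq_def base_def intro!: provable.ax[OF ax.ground_Fwd])
  moreover have "\<Sigma> \<turnstile> Bwd \<gamma> \<cdot> StateS s \<cdot> StateT t \<doteq> StateT (\<gamma> s t)" for t
    using assms by (auto simp: eq_def base_def intro!: provable.ax[OF ax.ground_Bwd])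
  ultimately show ?thesis
    unfolding simulates_def by (auto intro: forward.intros intro!: HOL.exI backward.intros(2))
qed

text \<open>The stacks are last in, first out. The backward run of \<open>C\<^sub>2\<close>, taken
  with \<open>\<sigma> @ \<sigma>\<^sub>0\<close> and \<open>\<Gamma> @ \<Gamma>\<^sub>0\<close> as
  the rest, stops exactly where that of \<open>C\<^sub>1\<close> starts, in the order in which the
  backward denotation composes.\<close>

lemma simulates_Seq:
  assumes C: "command \<Sigma> C\<^sub>1" "command \<Sigma> C\<^sub>2"
    and 1: "simulates \<Sigma> C\<^sub>1 s s' \<sigma> \<Gamma>" and 2: "simulates \<Sigma> C\<^sub>2 s' s'' \<sigma>' \<Gamma>'"
  shows "simulates \<Sigma> (Seq C\<^sub>1 C\<^sub>2) s s'' (\<sigma>' @ \<sigma>) (\<Gamma>' @ \<Gamma>)"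
proof -
  note wt = C[THEN wt_fwd] C[THEN wt_bwd]
  have f1: "\<Sigma> \<turnstile> fwd C\<^sub>1 \<cdot> StateS s \<doteq> StateS s'" and f2: "\<Sigma> \<turnstile> fwd C\<^sub>2 \<cdot> StateS s' \<doteq> StateS s''"
    using 1 2 by (auto simp: simulates_def)
  have "\<Sigma> \<turnstile> fwd (Seq C\<^sub>1 C\<^sub>2) \<cdot> StateS s \<doteq> fwd C\<^sub>2 \<cdot> (fwd C\<^sub>1 \<cdot> StateS s)"
    using beta_closed[of \<Sigma> "StateS s" S "fwd C\<^sub>2 \<cdot> (fwd C\<^sub>1 \<cdot> Var 0 S)" 0] wt
    by (simp del: lam.simps add: inst_closed)
  also have "\<Sigma> \<turnstile> fwd C\<^sub>2 \<cdot> (fwd C\<^sub>1 \<cdot> StateS s) \<doteq> fwd C\<^sub>2 \<cdot> StateS s'"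
    by (rule eq_arg_cong[OF f1]) (use wt in auto)
  also note f2
  finally have fwd: "\<Sigma> \<turnstile> fwd (Seq C\<^sub>1 C\<^sub>2) \<cdot> StateS s \<doteq> StateS s''" .
  have bwd: "\<exists>t'. (\<forall>\<sigma>\<^sub>0 \<Gamma>\<^sub>0. ((\<sigma>' @ \<sigma>) @ \<sigma>\<^sub>0, (\<Gamma>' @ \<Gamma>) @ \<Gamma>\<^sub>0, t) \<Rrightarrow> (\<sigma>\<^sub>0, \<Gamma>\<^sub>0, t')) \<and>
      \<Sigma> \<turnstile> bwd (Seq C\<^sub>1 C\<^sub>2) \<cdot> StateS s \<cdot> StateT t \<doteq> StateT t'" for t
  proof -
    obtain t1 where r2: "\<And>\<sigma>\<^sub>0 \<Gamma>\<^sub>0. (\<sigma>' @ \<sigma>\<^sub>0, \<Gamma>' @ \<Gamma>\<^sub>0, t) \<Rrightarrow> (\<sigma>\<^sub>0, \<Gamma>\<^sub>0, t1)"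
      and b2: "\<Sigma> \<turnstile> bwd C\<^sub>2 \<cdot> StateS s' \<cdot> StateT t \<doteq> StateT t1"
      using 2 unfolding simulates_def by blast
    obtain t2 where r1: "\<And>\<sigma>\<^sub>0 \<Gamma>\<^sub>0. (\<sigma> @ \<sigma>\<^sub>0, \<Gamma> @ \<Gamma>\<^sub>0, t1) \<Rrightarrow> (\<sigma>\<^sub>0, \<Gamma>\<^sub>0, t2)"
      and b1: "\<Sigma> \<turnstile> bwd C\<^sub>1 \<cdot> StateS s \<cdot> StateT t1 \<doteq> StateT t2"
      using 1 unfolding simulates_def by blast
    have "\<Sigma> \<turnstile> bwd (Seq C\<^sub>1 C\<^sub>2) \<cdot> StateS s \<cdot> StateT t
        \<doteq> bwd C\<^sub>1 \<cdot> StateS s \<cdot> (bwd C\<^sub>2 \<cdot> (fwd C\<^sub>1 \<cdot> StateS s) \<cdot> StateT t)"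
      using beta2_closed[of \<Sigma> "StateS s" S "StateT t" T
          "bwd C\<^sub>1 \<cdot> Var 0 S \<cdot> (bwd C\<^sub>2 \<cdot> (fwd C\<^sub>1 \<cdot> Var 0 S) \<cdot> Var 1 T)" 0 1] wt
      by (simp del: lam.simps add: inst_closed)
    also have "\<Sigma> \<turnstile> bwd C\<^sub>1 \<cdot> StateS s \<cdot> (bwd C\<^sub>2 \<cdot> (fwd C\<^sub>1 \<cdot> StateS s) \<cdot> StateT t)
        \<doteq> bwd C\<^sub>1 \<cdot> StateS s \<cdot> (bwd C\<^sub>2 \<cdot> StateS s' \<cdot> StateT t)"
      by (intro eq_arg_cong eq_fun_cong f1) (use wt in auto)
    also have "\<Sigma> \<turnstile> bwd C\<^sub>1 \<cdot> StateS s \<cdot> (bwd C\<^sub>2 \<cdot> StateS s' \<cdot> StateT t)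
        \<doteq> bwd C\<^sub>1 \<cdot> StateS s \<cdot> StateT t1"
      by (rule eq_arg_cong[OF b2]) (use wt in auto)
    also note b1
    finally have "\<Sigma> \<turnstile> bwd (Seq C\<^sub>1 C\<^sub>2) \<cdot> StateS s \<cdot> StateT t \<doteq> StateT t2" .
    moreover have "((\<sigma>' @ \<sigma>) @ \<sigma>\<^sub>0, (\<Gamma>' @ \<Gamma>) @ \<Gamma>\<^sub>0, t) \<Rrightarrow> (\<sigma>\<^sub>0, \<Gamma>\<^sub>0, t2)" for \<sigma>\<^sub>0 \<Gamma>\<^sub>0
      using backward.intros(3)[OF r2 r1] by simp
    ultimately show ?thesis by blast
  qed
  have "(s, C\<^sub>1) \<Down> (s', \<sigma>, \<Gamma>)" "(s', C\<^sub>2) \<Down> (s'', \<sigma>', \<Gamma>')"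
    using 1 2 by (auto simp: simulates_def)
  from forward.intros(3)[OF this] fwd bwd show ?thesis
    unfolding simulates_def by (intro conjI HOL.allI)
qed

text \<open>At a named state the theory decides \<open>\<phi>\<close>, so both denotations provably
  agree with those of the branch taken, and its simulation carries over by transitivity.\<close>

lemma simulates_Cond:
  assumes C: "\<phi> \<in> Exps \<Sigma>" "command \<Sigma> C\<^sub>1" "command \<Sigma> C\<^sub>2"
    and sim: "simulates \<Sigma> (if \<phi> s then C\<^sub>1 else C\<^sub>2) s s' \<sigma> \<Gamma>"
  shows "simulates \<Sigma> (Cond \<phi> C\<^sub>1 C\<^sub>2) s s' \<sigma> \<Gamma>"
proof -
  note wt = C(2,3)[THEN wt_fwd] C(2,3)[THEN wt_bwd]
  let ?C = "if \<phi> s then C\<^sub>1 else C\<^sub>2"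
  have "\<Sigma> \<turnstile> fwd (Cond \<phi> C\<^sub>1 C\<^sub>2) \<cdot> StateS s
      \<doteq> CaseExp \<phi> S \<cdot> StateS s \<cdot> (fwd C\<^sub>1 \<cdot> StateS s) \<cdot> (fwd C\<^sub>2 \<cdot> StateS s)"
    using beta_closed[of \<Sigma> "StateS s" S
        "CaseExp \<phi> S \<cdot> Var 0 S \<cdot> (fwd C\<^sub>1 \<cdot> Var 0 S) \<cdot> (fwd C\<^sub>2 \<cdot> Var 0 S)" 0] wt C(1)
    by (simp del: lam.simps add: inst_closed)
  also have "\<Sigma> \<turnstile> CaseExp \<phi> S \<cdot> StateS s \<cdot> (fwd C\<^sub>1 \<cdot> StateS s) \<cdot> (fwd C\<^sub>2 \<cdot> StateS s)
      \<doteq> fwd ?C \<cdot> StateS s"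
    using eq_CaseExp[OF C(1), of "fwd C\<^sub>1 \<cdot> StateS s" "fwd C\<^sub>2 \<cdot> StateS s" S s] wt
    by (simp split: if_splits)
  finally have fwd: "\<Sigma> \<turnstile> fwd (Cond \<phi> C\<^sub>1 C\<^sub>2) \<cdot> StateS s \<doteq> fwd ?C \<cdot> StateS s" .
  have bwd: "\<Sigma> \<turnstile> bwd (Cond \<phi> C\<^sub>1 C\<^sub>2) \<cdot> StateS s \<cdot> StateT t \<doteq> bwd ?C \<cdot> StateS s \<cdot> StateT t" for t
  proof -
    have "\<Sigma> \<turnstile> bwd (Cond \<phi> C\<^sub>1 C\<^sub>2) \<cdot> StateS s \<cdot> StateT t
        \<doteq> CaseExp \<phi> T \<cdot> StateS s
          \<cdot> (bwd C\<^sub>1 \<cdot> StateS s \<cdot> StateT t) \<cdot> (bwd C\<^sub>2 \<cdot> StateS s \<cdot> StateT t)"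
      using beta2_closed[of \<Sigma> "StateS s" S "StateT t" T
          "CaseExp \<phi> T \<cdot> Var 0 S \<cdot> (bwd C\<^sub>1 \<cdot> Var 0 S \<cdot> Var 1 T) \<cdot> (bwd C\<^sub>2 \<cdot> Var 0 S \<cdot> Var 1 T)" 0 1]
        wt C(1)
      by (simp del: lam.simps add: inst_closed)
    also have "\<Sigma> \<turnstile> CaseExp \<phi> T \<cdot> StateS s
          \<cdot> (bwd C\<^sub>1 \<cdot> StateS s \<cdot> StateT t) \<cdot> (bwd C\<^sub>2 \<cdot> StateS s \<cdot> StateT t)
        \<doteq> bwd ?C \<cdot> StateS s \<cdot> StateT t"
      using eq_CaseExp[OF C(1), of "bwd C\<^sub>1 \<cdot> StateS s \<cdot> StateT t" "bwd C\<^sub>2 \<cdot> StateS s \<cdot> StateT t" T s] wt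
      by (simp split: if_splits)
    finally show ?thesis .
  qed
  have "(s, Cond \<phi> C\<^sub>1 C\<^sub>2) \<Down> (s', \<sigma>, \<Gamma>)"
    using sim by (cases "\<phi> s") (auto simp: simulates_def intro: forward.intros)
  then show ?thesis
    using sim eq_trans[OF fwd] eq_trans[OF bwd] unfolding simulates_def by blast
qed

text \<open>
  The provable descent condition only bounds the provably computed successor state. Since the theory
  decides the ground instances of \<open>\<prec>\<close> and is consistent, the descent is real, so execution
  terminates.
\<close>

lemma ex_simulates_While:
  assumes sig: "signature \<Sigma>" and C: "r \<in> Rels \<Sigma>" "\<phi> \<in> Exps \<Sigma>" "command \<Sigma> C"
    and dec: "\<Sigma> \<turnstile> All 0 S (Imp (Exp \<phi> (Var 0 S)) (Rel r (fwd C \<cdot> Var 0 S) (Var 0 S)))"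
    and body: "\<And>s. \<exists>s' \<sigma> \<Gamma>. simulates \<Sigma> C s s' \<sigma> \<Gamma>"
  shows "\<exists>s' \<sigma> \<Gamma>. simulates \<Sigma> (While r \<phi> C) s s' \<sigma> \<Gamma>"
proof -
  have "wf r" using sig C(1) by (auto simp: signature_def)
  then show ?thesis
  proof (induction s rule: wf_induct_rule)
    case (less s)
    let ?s = "StateS s"
    let ?u = "lam 0 S (Var 0 S)" and ?F = "lam 0 S (lam 1 S (Var 1 S))"
    let ?v = "lam 0 S (lam 1 T (Var 1 T))"
    let ?G = "lam 0 S (lam 1 (T \<rightarrow>\<^sub>t T) (lam 2 T
      (bwd C \<cdot> Var 0 S \<cdot> (Var 1 (T \<rightarrow>\<^sub>t T) \<cdot> Var 2 T))))"
    let ?W = "fwd (While r \<phi> C)" and ?B = "bwd (While r \<phi> C)"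
    note wt = wt_fwd[OF C(3)] wt_bwd[OF C(3)]
    have W: "wt \<Sigma> ?W" "ty_of ?W = S \<rightarrow>\<^sub>t S" and B: "wt \<Sigma> ?B" "ty_of ?B = S \<rightarrow>\<^sub>t T \<rightarrow>\<^sub>t T"
      using wt_fwd[of \<Sigma> "While r \<phi> C"] wt_bwd[of \<Sigma> "While r \<phi> C"] C by auto
    \<comment> \<open>The body is run even if the loop exits at \<open>s\<close>:
      \<open>eq_WRec\<close> refers to a named successor state in both cases.\<close>
    obtain s1 \<sigma> \<Gamma> where sim: "simulates \<Sigma> C s s1 \<sigma> \<Gamma>" using body by blast
    then have f: "\<Sigma> \<turnstile> fwd C \<cdot> ?s \<doteq> StateS s1" by (simp add: simulates_def)
    have desc: "\<Sigma> \<turnstile> Imp (Exp \<phi> ?s) (Rel r (fwd C \<cdot> ?s) ?s)"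
      using provable_fsubst[OF dec, of ?s] by (simp add: tsubst_notin)
    have Weq: "\<Sigma> \<turnstile> ?W \<cdot> ?s \<doteq> (if \<phi> s then ?F \<cdot> ?s \<cdot> (?W \<cdot> StateS s1) else ?u \<cdot> ?s)"
      unfolding fwd.simps
      by (rule eq_WRec[OF desc f]) (use wt in \<open>auto simp: wt_lam ty_of_lam simp del: lam.simps\<close>)
    have Beq: "\<Sigma> \<turnstile> ?B \<cdot> ?s \<doteq> (if \<phi> s then ?G \<cdot> ?s \<cdot> (?B \<cdot> StateS s1) else ?v \<cdot> ?s)"
      unfolding bwd.simps
      by (rule eq_WRec[OF desc f]) (use wt in \<open>auto simp: wt_lam ty_of_lam simp del: lam.simps\<close>)
    show ?case
    proof (cases "\<phi> s")
      case False
      have "\<Sigma> \<turnstile> ?W \<cdot> ?s \<doteq> StateS s"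
        using eq_trans[OF Weq] beta_closed[of \<Sigma> ?s S "Var 0 S" 0] False by (simp del: lam.simps)
      moreover have "\<Sigma> \<turnstile> ?B \<cdot> ?s \<cdot> StateT t \<doteq> StateT t" for t
        using eq_trans[OF eq_fun_cong[OF Beq, of T T "StateT t"]] False B
          beta2_closed[of \<Sigma> ?s S "StateT t" T "Var 1 T" 0 1] by (simp del: lam.simps)
      then have "\<exists>t'. (\<forall>\<sigma>\<^sub>0 \<Gamma>\<^sub>0. ([] @ \<sigma>\<^sub>0, [] @ \<Gamma>\<^sub>0, t) \<Rrightarrow> (\<sigma>\<^sub>0, \<Gamma>\<^sub>0, t')) \<and>
          \<Sigma> \<turnstile> ?B \<cdot> ?s \<cdot> StateT t \<doteq> StateT t'" for t
        by (intro HOL.exI[of _ t] conjI HOL.allI) (simp_all only: append_Nil backward.intros(1))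
      ultimately have "simulates \<Sigma> (While r \<phi> C) s s [] []"
        using forward.intros(7)[of \<phi> s r C, OF False] unfolding simulates_def
        by (intro conjI HOL.allI)
      then show ?thesis by blast
    next
      case True
      have rel: "\<Sigma> \<turnstile> Rel r (fwd C \<cdot> ?s) ?s"
        by (rule provable.mp[OF desc provable.ax[OF ax.ground_Exp_True[of \<phi>, OF True]]])
          (use C in simp)
      have eq: "\<Sigma> \<turnstile> Eq (fwd C \<cdot> ?s) (StateS s1)" "\<Sigma> \<turnstile> Eq ?s ?s"
        using f eq_refl[of \<Sigma> ?s] wt by (simp_all add: eq_def)
      \<comment> \<open>The ground axioms for \<open>r\<close> relate named states, so the term
        \<open>fwd C \<cdot> ?s\<close> is replaced by the name of its value before the
        contradiction can be reached.\<close>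
      have "\<Sigma> \<turnstile> Imp (Eq (fwd C \<cdot> ?s) (StateS s1)) (Imp (Eq ?s ?s)
          (Imp (Rel r (fwd C \<cdot> ?s) ?s) (Rel r (StateS s1) ?s)))"
        by (rule provable.ax[OF ax.eq_Rel]) (use wt C in \<open>auto simp: base_def\<close>)
      note rel = provable.mp[OF provable.mp[OF provable.mp[OF this eq(1)] eq(2)] rel]
      have "(s1, s) \<in> r"
      proof (rule ccontr)
        assume "(s1, s) \<notin> r"
        then have "\<Sigma> \<turnstile> Neg (Rel r (StateS s1) ?s)"
          using C(1) by (auto intro: provable.ax[OF ax.ground_Rel_False])
        from provable.mp[OF this rel] consistent[OF sig] show False by blast
      qed
      then obtain s2 \<sigma>' \<Gamma>' where sim': "simulates \<Sigma> (While r \<phi> C) s1 s2 \<sigma>' \<Gamma>'"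
        using less by blast
      \<comment> \<open>\<open>?F\<close> discards the current state and returns the recursive
        result, so the loop has the same forward value at \<open>s\<close> as at
        \<open>s1\<close>.\<close>
      have "\<Sigma> \<turnstile> ?F \<cdot> ?s \<cdot> (?W \<cdot> StateS s1) \<doteq> ?W \<cdot> StateS s1"
        using beta2_closed[of \<Sigma> ?s S "?W \<cdot> StateS s1" S "Var 1 S" 0 1] W
        by (simp del: lam.simps fwd.simps)
      then have fwd: "\<Sigma> \<turnstile> ?W \<cdot> ?s \<doteq> StateS s2"
        using eq_trans[OF eq_trans[OF Weq]] True sim' unfolding simulates_def by simp
      have bwd: "\<exists>t'. (\<forall>\<sigma>\<^sub>0 \<Gamma>\<^sub>0. ((\<sigma>' @ \<sigma>) @ \<sigma>\<^sub>0, (\<Gamma>' @ \<Gamma>) @ \<Gamma>\<^sub>0, t) \<Rrightarrow> (\<sigma>\<^sub>0, \<Gamma>\<^sub>0, t')) \<and>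
          \<Sigma> \<turnstile> ?B \<cdot> ?s \<cdot> StateT t \<doteq> StateT t'" for t
      proof -
        obtain t1 where r2: "\<And>\<sigma>\<^sub>0 \<Gamma>\<^sub>0. (\<sigma>' @ \<sigma>\<^sub>0, \<Gamma>' @ \<Gamma>\<^sub>0, t) \<Rrightarrow> (\<sigma>\<^sub>0, \<Gamma>\<^sub>0, t1)"
          and b2: "\<Sigma> \<turnstile> ?B \<cdot> StateS s1 \<cdot> StateT t \<doteq> StateT t1"
          using sim' unfolding simulates_def by blast
        obtain t2 where r1: "\<And>\<sigma>\<^sub>0 \<Gamma>\<^sub>0. (\<sigma> @ \<sigma>\<^sub>0, \<Gamma> @ \<Gamma>\<^sub>0, t1) \<Rrightarrow> (\<sigma>\<^sub>0, \<Gamma>\<^sub>0, t2)"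
          and b1: "\<Sigma> \<turnstile> bwd C \<cdot> ?s \<cdot> StateT t1 \<doteq> StateT t2"
          using sim unfolding simulates_def by blast
        have "\<Sigma> \<turnstile> ?B \<cdot> ?s \<cdot> StateT t \<doteq> ?G \<cdot> ?s \<cdot> (?B \<cdot> StateS s1) \<cdot> StateT t"
          using eq_fun_cong[OF Beq, of T T "StateT t"] True B
          by (simp del: lam.simps bwd.simps)
        \<comment> \<open>The backward pass of the remaining iterations ends up innermost: it acts
          on \<open>t\<close> first, just as \<open>\<sigma>'\<close> lies above
          \<open>\<sigma>\<close> on the stack.\<close>
        also have "\<Sigma> \<turnstile> ?G \<cdot> ?s \<cdot> (?B \<cdot> StateS s1) \<cdot> StateT t
            \<doteq> bwd C \<cdot> ?s \<cdot> (?B \<cdot> StateS s1 \<cdot> StateT t)"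
          using beta3_closed[of \<Sigma> ?s S "?B \<cdot> StateS s1" "T \<rightarrow>\<^sub>t T" "StateT t" T
              "bwd C \<cdot> Var 0 S \<cdot> (Var 1 (T \<rightarrow>\<^sub>t T) \<cdot> Var 2 T)" 0 1 2] wt B
          by (simp del: lam.simps bwd.simps add: inst_closed)
        also have "\<Sigma> \<turnstile> bwd C \<cdot> ?s \<cdot> (?B \<cdot> StateS s1 \<cdot> StateT t) \<doteq> bwd C \<cdot> ?s \<cdot> StateT t1"
          by (rule eq_arg_cong[OF b2]) (use wt B in \<open>auto simp del: bwd.simps\<close>)
        also note b1
        finally have "\<Sigma> \<turnstile> ?B \<cdot> ?s \<cdot> StateT t \<doteq> StateT t2" .
        moreover have "((\<sigma>' @ \<sigma>) @ \<sigma>\<^sub>0, (\<Gamma>' @ \<Gamma>) @ \<Gamma>\<^sub>0, t) \<Rrightarrow> (\<sigma>\<^sub>0, \<Gamma>\<^sub>0, t2)" for \<sigma>\<^sub>0 \<Gamma>\<^sub>0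
          using backward.intros(3)[OF r2 r1] by simp
        ultimately show ?thesis by blast
      qed
      have "(s, C) \<Down> (s1, \<sigma>, \<Gamma>)" "(s1, While r \<phi> C) \<Down> (s2, \<sigma>', \<Gamma>')"
        using sim sim' unfolding simulates_def by blast+
      from forward.intros(6)[of \<phi>, OF True this(1) \<open>(s1, s) \<in> r\<close> this(2)] fwd bwd
      have "simulates \<Sigma> (While r \<phi> C) s s2 (\<sigma>' @ \<sigma>) (\<Gamma>' @ \<Gamma>)"
        unfolding simulates_def by (intro conjI HOL.allI)
      then show ?thesis by blast
    qed
  qed
qed

lemma ex_simulates:
  assumes "signature \<Sigma>"
  shows "command \<Sigma> C \<Longrightarrow>
    (\<And>r \<phi> C\<^sub>1. While r \<phi> C\<^sub>1 \<in> subcommands C \<Longrightarrow>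
      \<Sigma> \<turnstile> All 0 S (Imp (Exp \<phi> (Var 0 S)) (Rel r (fwd C\<^sub>1 \<cdot> Var 0 S) (Var 0 S)))) \<Longrightarrow>
    \<exists>s' \<sigma> \<Gamma>. simulates \<Sigma> C s s' \<sigma> \<Gamma>"
proof (induction C arbitrary: s)
  case Skip
  show ?case by (intro HOL.exI) (rule simulates_Skip)
next
  case (Prim c \<gamma>)
  then have "c \<in> Comm_plus \<Sigma>" "\<gamma> \<in> Comm_minus \<Sigma>" by simp_all
  then show ?case by (intro HOL.exI) (rule simulates_Prim)
next
  case (Seq C\<^sub>1 C\<^sub>2)
  have C: "command \<Sigma> C\<^sub>1" "command \<Sigma> C\<^sub>2" using Seq.prems(1) by auto
  have "\<exists>s' \<sigma> \<Gamma>. simulates \<Sigma> C\<^sub>1 s s' \<sigma> \<Gamma>"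
    by (rule Seq.IH(1)[OF C(1)], rule Seq.prems(2)) simp
  then obtain s' \<sigma> \<Gamma> where 1: "simulates \<Sigma> C\<^sub>1 s s' \<sigma> \<Gamma>" by blast
  have "\<exists>s'' \<sigma> \<Gamma>. simulates \<Sigma> C\<^sub>2 s' s'' \<sigma> \<Gamma>"
    by (rule Seq.IH(2)[OF C(2)], rule Seq.prems(2)) simp
  then obtain s'' \<sigma>' \<Gamma>' where 2: "simulates \<Sigma> C\<^sub>2 s' s'' \<sigma>' \<Gamma>'" by blast
  show ?case by (intro HOL.exI) (rule simulates_Seq[OF C 1 2])
next
  case (Cond \<phi> C\<^sub>1 C\<^sub>2)
  have C: "\<phi> \<in> Exps \<Sigma>" "command \<Sigma> C\<^sub>1" "command \<Sigma> C\<^sub>2" using Cond.prems(1) by auto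
  have "\<exists>s' \<sigma> \<Gamma>. simulates \<Sigma> C\<^sub>1 s s' \<sigma> \<Gamma>"
    by (rule Cond.IH(1)[OF C(2)], rule Cond.prems(2)) simp
  moreover have "\<exists>s' \<sigma> \<Gamma>. simulates \<Sigma> C\<^sub>2 s s' \<sigma> \<Gamma>"
    by (rule Cond.IH(2)[OF C(3)], rule Cond.prems(2)) simp
  ultimately have "\<exists>s' \<sigma> \<Gamma>. simulates \<Sigma> (if \<phi> s then C\<^sub>1 else C\<^sub>2) s s' \<sigma> \<Gamma>" by simp
  then obtain s' \<sigma> \<Gamma> where "simulates \<Sigma> (if \<phi> s then C\<^sub>1 else C\<^sub>2) s s' \<sigma> \<Gamma>" by blast
  then show ?case by (intro HOL.exI) (rule simulates_Cond[OF C])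
next
  case (While r \<phi> C)
  have C: "r \<in> Rels \<Sigma>" "\<phi> \<in> Exps \<Sigma>" "command \<Sigma> C" using While.prems(1) by auto
  have "\<exists>s' \<sigma> \<Gamma>. simulates \<Sigma> C s s' \<sigma> \<Gamma>" for s
    by (rule While.IH[OF C(3)], rule While.prems(2)) simp
  moreover have "\<Sigma> \<turnstile> All 0 S (Imp (Exp \<phi> (Var 0 S)) (Rel r (fwd C \<cdot> Var 0 S) (Var 0 S)))"
    by (rule While.prems(2)) simp
  ultimately show ?case by (rule ex_simulates_While[OF assms C, rotated])
qed

theorem theorem8:
  fixes \<Sigma> :: "('s, 't) sig" and C :: "('s, 't) com"
  assumes "signature \<Sigma>" and "command \<Sigma> C"
    and "\<And>r \<phi> C\<^sub>1. While r \<phi> C\<^sub>1 \<in> subcommands C \<Longrightarrow>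
      \<Sigma> \<turnstile> All 0 S (Imp (Exp \<phi> (Var 0 S)) (Rel r (fwd C\<^sub>1 \<cdot> Var 0 S) (Var 0 S)))"
  shows "\<forall>s. \<exists>s' \<sigma> \<Gamma>.
    (s, C) \<Down> (s', \<sigma>, \<Gamma>) \<and>
    \<Sigma> \<turnstile> StateS s' \<doteq> fwd C \<cdot> StateS s \<and>
    (\<forall>t \<sigma>\<^sub>0 \<Gamma>\<^sub>0. \<exists>t'.
      (\<sigma> @ \<sigma>\<^sub>0, \<Gamma> @ \<Gamma>\<^sub>0, t) \<Rrightarrow> (\<sigma>\<^sub>0, \<Gamma>\<^sub>0, t') \<and>
      \<Sigma> \<turnstile> StateT t' \<doteq> bwd C \<cdot> StateS s \<cdot> StateT t)"
proof
  fix s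
  obtain s' \<sigma> \<Gamma> where sim: "simulates \<Sigma> C s s' \<sigma> \<Gamma>"
    using ex_simulates[OF assms] by blast
  have bwd: "\<exists>t'. (\<sigma> @ \<sigma>\<^sub>0, \<Gamma> @ \<Gamma>\<^sub>0, t) \<Rrightarrow> (\<sigma>\<^sub>0, \<Gamma>\<^sub>0, t') \<and>
      \<Sigma> \<turnstile> StateT t' \<doteq> bwd C \<cdot> StateS s \<cdot> StateT t" for t \<sigma>\<^sub>0 \<Gamma>\<^sub>0
  proof -
    obtain t' where "(\<sigma> @ \<sigma>\<^sub>0, \<Gamma> @ \<Gamma>\<^sub>0, t) \<Rrightarrow> (\<sigma>\<^sub>0, \<Gamma>\<^sub>0, t')"
      and "\<Sigma> \<turnstile> bwd C \<cdot> StateS s \<cdot> StateT t \<doteq> StateT t'"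
      using sim unfolding simulates_def by blast
    then show ?thesis using eq_sym by blast
  qed
  have run: "(s, C) \<Down> (s', \<sigma>, \<Gamma>)" and fwd: "\<Sigma> \<turnstile> StateS s' \<doteq> fwd C \<cdot> StateS s"
    using sim eq_sym unfolding simulates_def by blast+
  show "\<exists>s' \<sigma> \<Gamma>.
    (s, C) \<Down> (s', \<sigma>, \<Gamma>) \<and>
    \<Sigma> \<turnstile> StateS s' \<doteq> fwd C \<cdot> StateS s \<and>
    (\<forall>t \<sigma>\<^sub>0 \<Gamma>\<^sub>0. \<exists>t'.
      (\<sigma> @ \<sigma>\<^sub>0, \<Gamma> @ \<Gamma>\<^sub>0, t) \<Rrightarrow> (\<sigma>\<^sub>0, \<Gamma>\<^sub>0, t') \<and>
      \<Sigma> \<turnstile> StateT t' \<doteq> bwd C \<cdot> StateS s \<cdot> StateT t)"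
    by (rule HOL.exI[of _ s'], rule HOL.exI[of _ \<sigma>], rule HOL.exI[of _ \<Gamma>])
      (intro conjI HOL.allI run fwd bwd)
qed

end
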